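(* Let $d$ be an integer, and assume a triangulated category $\mathcal T$ and $M\in\mathsf{silt}\,\mathcal T$ satisfy the conditions (T0), (T1), (T2), (T3) listed in the context. Decompose $M=X\oplus X'$ with $(\mathsf{add}\,X)\cap(\mathsf{add}\,X')=0$ and put $S:=\mathrm{top}\,H^0X$. Then the following conditions are equivalent. 1. $\mu_X^-(M)\in\mathsf{silt}^d\,\mathcal T$. 2. $\mathcal T(S,X'[d])=0$.
   Context: $k$ is a field, categories are $k$-linear, $D=\mathrm{Hom}_k(-,k)$, and $\mathcal T(X,Y)$ denotes Hom spaces in $\mathcal T$. $M\in\mathcal T$ is silting if $\mathcal T(M,M[i])=0$ for all $i>0$ and $\mathcal T=\mathsf{thick}\,M$; $\mathsf{silt}\,\mathcal T$ is the class of silting objects. For $M,N\in\mathsf{silt}\,\mathcal T$, $M\ge N$ means $\mathcal T(M,N[i])=0$ for all $i>0$. Conditions: (T0) $\mathcal T$ is Hom-finite and Krull–Schmidt. (T1) $\mathcal T$ has a Serre functor $\nu$ (an autoequivalence with natural isomorphisms $\mathcal T(X,Y)\cong D\mathcal T(Y,\nu X)$); put $\nu_d:=\nu\circ[-d]$. (T2) $M$ admits a right adjacent t-structure: the pair $\mathcal T_M^{\le0}:=\{X\mid\mathcal T(M,X[i])=0\ \forall i>0\}$, $\mathcal T_M^{\ge0}:=\{X\mid\mathcal T(M,X[i])=0\ \forall i<0\}$ is a t-structure on $\mathcal T$; its heart is $\mathcal H_M:=\mathcal T_M^{\le0}\cap\mathcal T_M^{\ge0}$ and $H^0\colon\mathcal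 T\to\mathcal H_M$ is the associated cohomological functor. (T3) $M\in\mathsf{silt}^d\,\mathcal T$, where $\mathsf{silt}^d\,\mathcal T:=\{N\in\mathsf{silt}\,\mathcal T\mid N\ge\nu_d^{-1}N\}$ is the class of $d$-silting objects. $\mathrm{top}\,H^0X$ is the largest semisimple quotient of $H^0X$ in the abelian category $\mathcal H_M$ (where $H^0M$ is a projective generator). For a silting object $M=X\oplus X'$ with $(\mathsf{add}\,X)\cap(\mathsf{add}\,X')=0$, take a left $(\mathsf{add}\,X')$-approximation $X\to X'_0$ and a triangle $X\to X'_0\to Y\to X[1]$; the left mutation is $\mu_X^-(M):=Y\oplus X'$, a silting object (well defined up to additive closure). *)

theory Defs
  imports Main "HOL.Vector_Spaces"
begin

section \<open>Linear categories\<close>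

text \<open>
  A small \<open>k\<close>-linear category.  The objects are all elements of the type \<open>'o\<close>, and \<open>k\<close> is the type
  \<open>'k\<close> of class \<open>field\<close>.  All Hom spaces are subspaces of one ambient vector space \<open>'m\<close>, for
  instance of the direct sum of all the Hom spaces; there, composition and the action of a functor
  on morphisms extend bilinearly and linearly, respectively, so that they need no object arguments.
  The Hom spaces share their zero element, hence a morphism does not determine its source and
  target, and these are always given explicitly.
\<close>

record ('k, 'o, 'm) linear_cat =
  scl :: "'k \<Rightarrow> 'm \<Rightarrow> 'm"
  Hom :: "'o \<Rightarrow> 'o \<Rightarrow> 'm set"
  comp :: "'m \<Rightarrow> 'm \<Rightarrow> 'm"  (infixl \<open>\<cdot>\<index>\<close> 70)
  Id :: "'o \<Rightarrow> 'm"

text \<open>\<open>g \<cdot> f\<close> is ``first \<open>f\<close>, then \<open>g\<close>''.\<close>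

locale linear_category = vector_space "scl C"
  for C :: "('k::field, 'o, 'm::ab_group_add, 'z) linear_cat_scheme" (structure) +
  assumes Hom_subspace: "subspace (Hom C X Y)"
    and comp_in_Hom: "f \<in> Hom C X Y \<Longrightarrow> g \<in> Hom C Y Z \<Longrightarrow> g \<cdot> f \<in> Hom C X Z"
    and Id_in_Hom: "Id C X \<in> Hom C X X"
    and comp_Id_right: "f \<in> Hom C X Y \<Longrightarrow> f \<cdot> Id C X = f"
    and comp_Id_left: "f \<in> Hom C X Y \<Longrightarrow> Id C Y \<cdot> f = f"
    and comp_assoc: "f \<in> Hom C W X \<Longrightarrow> g \<in> Hom C X Y \<Longrightarrow> h \<in> Hom C Y Z \<Longrightarrow>
          (h \<cdot> g) \<cdot> f = h \<cdot> (g \<cdot> f)"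
    and comp_add_left: "f \<in> Hom C X Y \<Longrightarrow> g \<in> Hom C Y Z \<Longrightarrow> g' \<in> Hom C Y Z \<Longrightarrow>
          (g + g') \<cdot> f = g \<cdot> f + g' \<cdot> f"
    and comp_add_right: "f \<in> Hom C X Y \<Longrightarrow> f' \<in> Hom C X Y \<Longrightarrow> g \<in> Hom C Y Z \<Longrightarrow>
          g \<cdot> (f + f') = g \<cdot> f + g \<cdot> f'"
    and comp_scl_left: "f \<in> Hom C X Y \<Longrightarrow> g \<in> Hom C Y Z \<Longrightarrow> scl C a g \<cdot> f = scl C a (g \<cdot> f)"
    and comp_scl_right: "f \<in> Hom C X Y \<Longrightarrow> g \<in> Hom C Y Z \<Longrightarrow> g \<cdot> scl C a f = scl C a (g \<cdot> f)"

definition is_iso ::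
  "('k, 'o, 'm, 'z) linear_cat_scheme \<Rightarrow> 'o \<Rightarrow> 'o \<Rightarrow> 'm \<Rightarrow> bool" where
  "is_iso C X Y f \<longleftrightarrow> f \<in> Hom C X Y \<and>
     (\<exists>g\<in>Hom C Y X. g \<cdot>\<^bsub>C\<^esub> f = Id C X \<and> f \<cdot>\<^bsub>C\<^esub> g = Id C Y)"

definition zero_object ::
  "('k, 'o, 'm::zero, 'z) linear_cat_scheme \<Rightarrow> 'o \<Rightarrow> bool" where
  "zero_object C X \<longleftrightarrow> (\<forall>Y. Hom C X Y = {0} \<and> Hom C Y X = {0})"

text \<open>\<open>direct_sum C Ys W\<close>: the object \<open>W\<close> is a direct sum (biproduct) of the finite family \<open>Ys\<close>.\<close>

definition direct_sum ::
  "('k, 'o, 'm::ab_group_add, 'z) linear_cat_scheme \<Rightarrow> 'o list \<Rightarrow> 'o \<Rightarrow> bool" where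
  "direct_sum C Ys W \<longleftrightarrow> (\<exists>\<iota> \<pi>.
     (\<forall>i<length Ys. \<iota> i \<in> Hom C (Ys ! i) W \<and> \<pi> i \<in> Hom C W (Ys ! i)) \<and>
     (\<forall>i<length Ys. \<forall>j<length Ys. \<pi> i \<cdot>\<^bsub>C\<^esub> \<iota> j = (if i = j then Id C (Ys ! i) else 0)) \<and>
     (\<Sum>i<length Ys. \<iota> i \<cdot>\<^bsub>C\<^esub> \<pi> i) = Id C W)"

locale additive_linear_category = linear_category +
  assumes ex_zero_object: "\<exists>Z. zero_object C Z"
    and ex_direct_sum: "\<exists>W. direct_sum C [X, Y] W"

definition add_closure ::
  "('k, 'o, 'm::ab_group_add, 'z) linear_cat_scheme \<Rightarrow> 'o \<Rightarrow> 'o set" where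
  "add_closure C X = {Y. \<exists>n W Y'. direct_sum C (replicate n X) W \<and> direct_sum C [Y, Y'] W}"

definition Hom_finite ::
  "('k::field, 'o, 'm::ab_group_add, 'z) linear_cat_scheme \<Rightarrow> bool" where
  "Hom_finite C \<longleftrightarrow> (\<forall>X Y. \<exists>B. finite B \<and> module.span (scl C) B = Hom C X Y)"

text \<open>The ring \<open>End(X)\<close> is local: it is nonzero and its non-units are closed under addition.\<close>

definition local_End ::
  "('k, 'o, 'm::ab_group_add, 'z) linear_cat_scheme \<Rightarrow> 'o \<Rightarrow> bool" where
  "local_End C X \<longleftrightarrow> Id C X \<noteq> 0 \<and>
     (\<forall>f\<in>Hom C X X. \<forall>g\<in>Hom C X X. \<not> is_iso C X X f \<longrightarrow> \<not> is_iso C X X g \<longrightarrow> \<not> is_iso C X X (f + g))"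

definition Krull_Schmidt ::
  "('k, 'o, 'm::ab_group_add, 'z) linear_cat_scheme \<Rightarrow> bool" where
  "Krull_Schmidt C \<longleftrightarrow> (\<forall>X. \<exists>Ys. (\<forall>Y\<in>set Ys. local_End C Y) \<and> direct_sum C Ys X)"


section \<open>Autoequivalences and Serre functors\<close>

record ('o, 'm) endofunctor =
  ob :: "'o \<Rightarrow> 'o"
  mor :: "'m \<Rightarrow> 'm"

definition linear_functor ::
  "('k, 'o, 'm::ab_group_add, 'z) linear_cat_scheme \<Rightarrow> ('o, 'm) endofunctor \<Rightarrow> bool" where
  "linear_functor C F \<longleftrightarrow>
     (\<forall>X Y. \<forall>f\<in>Hom C X Y. mor F f \<in> Hom C (ob F X) (ob F Y)) \<and>
     (\<forall>X. mor F (Id C X) = Id C (ob F X)) \<and>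
     (\<forall>X Y Z. \<forall>f\<in>Hom C X Y. \<forall>g\<in>Hom C Y Z. mor F (g \<cdot>\<^bsub>C\<^esub> f) = mor F g \<cdot>\<^bsub>C\<^esub> mor F f) \<and>
     (\<forall>X Y. \<forall>f\<in>Hom C X Y. \<forall>g\<in>Hom C X Y. mor F (f + g) = mor F f + mor F g) \<and>
     (\<forall>X Y. \<forall>f\<in>Hom C X Y. \<forall>a. mor F (scl C a f) = scl C a (mor F f))"

definition comp_iso_identity ::
  "('k, 'o, 'm, 'z) linear_cat_scheme \<Rightarrow> ('o, 'm) endofunctor \<Rightarrow> ('o, 'm) endofunctor \<Rightarrow> bool" where
  "comp_iso_identity C G F \<longleftrightarrow> (\<exists>\<alpha>.
     (\<forall>X. is_iso C (ob G (ob F X)) X (\<alpha> X)) \<and>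
     (\<forall>X Y. \<forall>f\<in>Hom C X Y. f \<cdot>\<^bsub>C\<^esub> \<alpha> X = \<alpha> Y \<cdot>\<^bsub>C\<^esub> mor G (mor F f)))"

definition quasi_inverse ::
  "('k, 'o, 'm::ab_group_add, 'z) linear_cat_scheme \<Rightarrow>
   ('o, 'm) endofunctor \<Rightarrow> ('o, 'm) endofunctor \<Rightarrow> bool" where
  "quasi_inverse C F G \<longleftrightarrow> linear_functor C F \<and> linear_functor C G \<and>
     comp_iso_identity C G F \<and> comp_iso_identity C F G"

definition autoequivalence ::
  "('k, 'o, 'm::ab_group_add, 'z) linear_cat_scheme \<Rightarrow> ('o, 'm) endofunctor \<Rightarrow> bool" where
  "autoequivalence C F \<longleftrightarrow> (\<exists>G. quasi_inverse C F G)"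

text \<open>
  The dual \<open>Hom\<^sub>k(V, k)\<close> of a subspace \<open>V\<close> of \<open>'m\<close>.  A functional on \<open>V\<close> is represented by its
  extension by zero to all of \<open>'m\<close> (this extension is usually not linear on \<open>'m\<close>).
\<close>

definition dual ::
  "('k::field, 'o, 'm::ab_group_add, 'z) linear_cat_scheme \<Rightarrow> 'm set \<Rightarrow> ('m \<Rightarrow> 'k) set" where
  "dual C V = {\<phi>. (\<forall>f\<in>V. \<forall>g\<in>V. \<phi> (f + g) = \<phi> f + \<phi> g) \<and>
                  (\<forall>f\<in>V. \<forall>a. \<phi> (scl C a f) = a * \<phi> f) \<and>
                  (\<forall>f. f \<notin> V \<longrightarrow> \<phi> f = 0)}"

text \<open>
  \<open>\<eta> X Y\<close> is the isomorphism from \<open>Hom(X, Y)\<close> to the dual of \<open>Hom(Y, \<nu> X)\<close>; the last clause is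
  naturality in both variables: \<open>b \<cdot> f \<cdot> a\<close> is sent to the functional \<open>\<eta> X Y f \<circ> (g \<mapsto> \<nu>(a) \<cdot> g \<cdot> b)\<close>.
\<close>

definition Serre_functor ::
  "('k::field, 'o, 'm::ab_group_add, 'z) linear_cat_scheme \<Rightarrow> ('o, 'm) endofunctor \<Rightarrow> bool" where
  "Serre_functor C \<nu> \<longleftrightarrow> autoequivalence C \<nu> \<and> (\<exists>\<eta>.
     (\<forall>X Y. bij_betw (\<eta> X Y) (Hom C X Y) (dual C (Hom C Y (ob \<nu> X)))) \<and>
     (\<forall>X Y. \<forall>f\<in>Hom C X Y. \<forall>f'\<in>Hom C X Y. \<eta> X Y (f + f') = (\<lambda>g. \<eta> X Y f g + \<eta> X Y f' g)) \<and>
     (\<forall>X Y. \<forall>f\<in>Hom C X Y. \<forall>a. \<eta> X Y (scl C a f) = (\<lambda>g. a * \<eta> X Y f g)) \<and>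
     (\<forall>X X' Y Y'. \<forall>a\<in>Hom C X' X. \<forall>b\<in>Hom C Y Y'. \<forall>f\<in>Hom C X Y. \<forall>g\<in>Hom C Y' (ob \<nu> X').
        \<eta> X' Y' (b \<cdot>\<^bsub>C\<^esub> f \<cdot>\<^bsub>C\<^esub> a) g = \<eta> X Y f (mor \<nu> a \<cdot>\<^bsub>C\<^esub> g \<cdot>\<^bsub>C\<^esub> b)))"


section \<open>Triangulated categories\<close>

text \<open>
  \<open>dist T X Y Z f g h\<close>: the sequence \<open>X \<rightarrow> Y \<rightarrow> Z \<rightarrow> X[1]\<close> with maps \<open>f\<close>, \<open>g\<close>, \<open>h\<close> is a distinguished
  triangle.
\<close>

record ('k, 'o, 'm) tri_cat = "('k, 'o, 'm) linear_cat" +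
  shift :: "('o, 'm) endofunctor"
  dist :: "'o \<Rightarrow> 'o \<Rightarrow> 'o \<Rightarrow> 'm \<Rightarrow> 'm \<Rightarrow> 'm \<Rightarrow> bool"

abbreviation sh1 :: "('k, 'o, 'm, 'z) tri_cat_scheme \<Rightarrow> 'o \<Rightarrow> 'o" where
  "sh1 T \<equiv> ob (shift T)"

abbreviation shm :: "('k, 'o, 'm, 'z) tri_cat_scheme \<Rightarrow> 'm \<Rightarrow> 'm" where
  "shm T \<equiv> mor (shift T)"

text \<open>\<open>sh T i X\<close> is \<open>X[i]\<close>; the shift functor is an automorphism of the category.\<close>

definition sh :: "('k, 'o, 'm, 'z) tri_cat_scheme \<Rightarrow> int \<Rightarrow> 'o \<Rightarrow> 'o" where
  "sh T i = (if 0 \<le> i then sh1 T ^^ nat i else inv (sh1 T) ^^ nat (- i))"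

text \<open>Verdier's axioms; \<open>octahedral\<close> concerns \<open>X \<rightarrow> Y \<rightarrow> Z\<close> with cones \<open>A\<close>, \<open>B\<close>, \<open>C\<close> of \<open>f\<close>, \<open>g \<cdot> f\<close>, \<open>g\<close>.\<close>

locale triangulated_category = additive_linear_category T
  for T :: "('k::field, 'o, 'm::ab_group_add, 'z) tri_cat_scheme" (structure) +
  assumes shift_functor: "linear_functor T (shift T)"
    and shift_bij_ob: "bij (sh1 T)"
    and shift_bij_mor: "bij_betw (shm T) (Hom T X Y) (Hom T (sh1 T X) (sh1 T Y))"
    and dist_in_Hom: "dist T X Y Z f g h \<Longrightarrow>
          f \<in> Hom T X Y \<and> g \<in> Hom T Y Z \<and> h \<in> Hom T Z (sh1 T X)"
    and dist_Id: "zero_object T Z \<Longrightarrow> dist T X X Z (Id T X) 0 0"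
    and dist_iso: "dist T X Y Z f g h \<Longrightarrow>
          f' \<in> Hom T X' Y' \<Longrightarrow> g' \<in> Hom T Y' Z' \<Longrightarrow> h' \<in> Hom T Z' (sh1 T X') \<Longrightarrow>
          is_iso T X X' a \<Longrightarrow> is_iso T Y Y' b \<Longrightarrow> is_iso T Z Z' c \<Longrightarrow>
          b \<cdot> f = f' \<cdot> a \<Longrightarrow> c \<cdot> g = g' \<cdot> b \<Longrightarrow> shm T a \<cdot> h = h' \<cdot> c \<Longrightarrow>
          dist T X' Y' Z' f' g' h'"
    and ex_cone: "f \<in> Hom T X Y \<Longrightarrow> \<exists>Z g h. dist T X Y Z f g h"
    and dist_rotate: "f \<in> Hom T X Y \<Longrightarrow> g \<in> Hom T Y Z \<Longrightarrow> h \<in> Hom T Z (sh1 T X) \<Longrightarrow>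
          dist T X Y Z f g h \<longleftrightarrow> dist T Y Z (sh1 T X) g h (- shm T f)"
    and dist_morphism: "dist T X Y Z f g h \<Longrightarrow> dist T X' Y' Z' f' g' h' \<Longrightarrow>
          a \<in> Hom T X X' \<Longrightarrow> b \<in> Hom T Y Y' \<Longrightarrow> b \<cdot> f = f' \<cdot> a \<Longrightarrow>
          \<exists>c\<in>Hom T Z Z'. c \<cdot> g = g' \<cdot> b \<and> shm T a \<cdot> h = h' \<cdot> c"
    and octahedral: "f \<in> Hom T X Y \<Longrightarrow> g \<in> Hom T Y Z \<Longrightarrow>
          dist T X Y A f i j \<Longrightarrow> dist T X Z B (g \<cdot> f) k l \<Longrightarrow> dist T Y Z C g m n \<Longrightarrow>
          \<exists>u v. dist T A B C u v (shm T i \<cdot> n) \<and>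
            u \<cdot> i = k \<cdot> g \<and> l \<cdot> u = j \<and> v \<cdot> k = m \<and> n \<cdot> v = shm T f \<cdot> l"


section \<open>Silting objects and mutation\<close>

definition thick_subcategory ::
  "('k, 'o, 'm::ab_group_add, 'z) tri_cat_scheme \<Rightarrow> 'o set \<Rightarrow> bool" where
  "thick_subcategory T A \<longleftrightarrow>
     (\<forall>X. zero_object T X \<longrightarrow> X \<in> A) \<and>
     (\<forall>X. sh1 T X \<in> A \<longleftrightarrow> X \<in> A) \<and>
     (\<forall>X Y Z f g h. dist T X Y Z f g h \<longrightarrow> X \<in> A \<longrightarrow> Y \<in> A \<longrightarrow> Z \<in> A) \<and>
     (\<forall>X Y W. direct_sum T [X, Y] W \<longrightarrow> W \<in> A \<longrightarrow> X \<in> A)"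

definition thick :: "('k, 'o, 'm::ab_group_add, 'z) tri_cat_scheme \<Rightarrow> 'o \<Rightarrow> 'o set" where
  "thick T M = \<Inter>{A. thick_subcategory T A \<and> M \<in> A}"

definition silting :: "('k, 'o, 'm::ab_group_add, 'z) tri_cat_scheme \<Rightarrow> 'o \<Rightarrow> bool" where
  "silting T M \<longleftrightarrow> (\<forall>i>0. Hom T M (sh T i M) = {0}) \<and> thick T M = UNIV"

definition silt_ge :: "('k, 'o, 'm::ab_group_add, 'z) tri_cat_scheme \<Rightarrow> 'o \<Rightarrow> 'o \<Rightarrow> bool" where
  "silt_ge T M N \<longleftrightarrow> (\<forall>i>0. Hom T M (sh T i N) = {0})"

text \<open>
  The parameter \<open>\<nu>'\<close> is a quasi-inverse of the Serre functor \<open>\<nu>\<close>, so that \<open>[d] \<circ> \<nu>'\<close> is a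
  quasi-inverse of \<open>\<nu>\<^sub>d = \<nu> \<circ> [-d]\<close>.
\<close>

definition nu_d_inv ::
  "('k, 'o, 'm, 'z) tri_cat_scheme \<Rightarrow> ('o, 'm) endofunctor \<Rightarrow> int \<Rightarrow> 'o \<Rightarrow> 'o" where
  "nu_d_inv T \<nu>' d X = sh T d (ob \<nu>' X)"

definition d_silting ::
  "('k, 'o, 'm::ab_group_add, 'z) tri_cat_scheme \<Rightarrow> ('o, 'm) endofunctor \<Rightarrow> int \<Rightarrow> 'o \<Rightarrow> bool" where
  "d_silting T \<nu>' d N \<longleftrightarrow> silting T N \<and> silt_ge T N (nu_d_inv T \<nu>' d N)"

definition left_approximation ::
  "('k, 'o, 'm, 'z) linear_cat_scheme \<Rightarrow> 'o set \<Rightarrow> 'o \<Rightarrow> 'o \<Rightarrow> 'm \<Rightarrow> bool" where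
  "left_approximation C A X A0 f \<longleftrightarrow> A0 \<in> A \<and> f \<in> Hom C X A0 \<and>
     (\<forall>W\<in>A. \<forall>g\<in>Hom C X W. \<exists>h\<in>Hom C A0 W. g = h \<cdot>\<^bsub>C\<^esub> f)"

text \<open>
  \<open>left_mutation T X X' N\<close>: the object \<open>N\<close> is a left mutation of \<open>X \<oplus> X'\<close> at \<open>X\<close>.  This is a relation,
  as a left mutation depends on the choice of the approximation, the triangle and the direct sum.
\<close>

definition left_mutation ::
  "('k, 'o, 'm::ab_group_add, 'z) tri_cat_scheme \<Rightarrow> 'o \<Rightarrow> 'o \<Rightarrow> 'o \<Rightarrow> bool" where
  "left_mutation T X X' N \<longleftrightarrow> (\<exists>X0' Y f g h.
     left_approximation T (add_closure T X') X X0' f \<and> dist T X X0' Y f g h \<and>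
     direct_sum T [Y, X'] N)"


section \<open>The silting t-structure, its heart, and tops\<close>

text \<open>
  A t-structure is given by the classes \<open>U = T\<^sup>\<le>\<^sup>0\<close> and \<open>V = T\<^sup>\<ge>\<^sup>0\<close>; then \<open>T\<^sup>\<le>\<^sup>n = U[-n]\<close> and
  \<open>T\<^sup>\<ge>\<^sup>n = V[-n]\<close>.
\<close>

definition trunc_class ::
  "('k, 'o, 'm, 'z) tri_cat_scheme \<Rightarrow> 'o set \<Rightarrow> int \<Rightarrow> 'o set" where
  "trunc_class T U n = {X. sh T n X \<in> U}"

text \<open>\<open>A\<close> and \<open>B\<close> are the truncations of \<open>X\<close> in degrees \<open>\<le> n\<close> and \<open>> n\<close>.\<close>

definition truncation ::
  "('k, 'o, 'm, 'z) tri_cat_scheme \<Rightarrow> 'o set \<Rightarrow> 'o set \<Rightarrow> int \<Rightarrow> 'o \<Rightarrow> 'o \<Rightarrow> 'o \<Rightarrow> bool" where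
  "truncation T U V n X A B \<longleftrightarrow> A \<in> trunc_class T U n \<and> B \<in> trunc_class T V (n + 1) \<and>
     (\<exists>f g h. dist T A X B f g h)"

definition t_structure ::
  "('k, 'o, 'm::ab_group_add, 'z) tri_cat_scheme \<Rightarrow> 'o set \<Rightarrow> 'o set \<Rightarrow> bool" where
  "t_structure T U V \<longleftrightarrow>
     (\<forall>X Y f. is_iso T X Y f \<longrightarrow> (X \<in> U \<longleftrightarrow> Y \<in> U) \<and> (X \<in> V \<longleftrightarrow> Y \<in> V)) \<and>
     U \<subseteq> trunc_class T U 1 \<and> trunc_class T V 1 \<subseteq> V \<and>
     (\<forall>X\<in>U. \<forall>Y\<in>trunc_class T V 1. Hom T X Y = {0}) \<and>
     (\<forall>X. \<exists>A B. truncation T U V 0 X A B)"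

definition silt_le0 :: "('k, 'o, 'm::ab_group_add, 'z) tri_cat_scheme \<Rightarrow> 'o \<Rightarrow> 'o set" where
  "silt_le0 T M = {X. \<forall>i>0. Hom T M (sh T i X) = {0}}"

definition silt_ge0 :: "('k, 'o, 'm::ab_group_add, 'z) tri_cat_scheme \<Rightarrow> 'o \<Rightarrow> 'o set" where
  "silt_ge0 T M = {X. \<forall>i<0. Hom T M (sh T i X) = {0}}"

definition admits_right_adjacent_t_structure ::
  "('k, 'o, 'm::ab_group_add, 'z) tri_cat_scheme \<Rightarrow> 'o \<Rightarrow> bool" where
  "admits_right_adjacent_t_structure T M \<longleftrightarrow> t_structure T (silt_le0 T M) (silt_ge0 T M)"

definition heart :: "('k, 'o, 'm::ab_group_add, 'z) tri_cat_scheme \<Rightarrow> 'o \<Rightarrow> 'o set" where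
  "heart T M = silt_le0 T M \<inter> silt_ge0 T M"

text \<open>
  \<open>is_H0 T M X H\<close>: the object \<open>H\<close> is (a representative of) \<open>H\<^sup>0 X = \<tau>\<^sup>\<ge>\<^sup>0 \<tau>\<^sup>\<le>\<^sup>0 X\<close>, which is determined
  up to isomorphism; \<open>A\<close> is \<open>\<tau>\<^sup>\<le>\<^sup>0 X\<close>.
\<close>

definition is_H0 :: "('k, 'o, 'm::ab_group_add, 'z) tri_cat_scheme \<Rightarrow> 'o \<Rightarrow> 'o \<Rightarrow> 'o \<Rightarrow> bool" where
  "is_H0 T M X H \<longleftrightarrow> (\<exists>A B A'. truncation T (silt_le0 T M) (silt_ge0 T M) 0 X A B \<and>
     truncation T (silt_le0 T M) (silt_ge0 T M) (-1) A A' H)"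

text \<open>
  The following notions refer to the full subcategory on the class \<open>A\<close> of objects; in particular
  monomorphisms and epimorphisms are tested on objects of \<open>A\<close> only.
\<close>

definition mono_in ::
  "('k, 'o, 'm, 'z) linear_cat_scheme \<Rightarrow> 'o set \<Rightarrow> 'o \<Rightarrow> 'o \<Rightarrow> 'm \<Rightarrow> bool" where
  "mono_in C A X Y f \<longleftrightarrow> X \<in> A \<and> Y \<in> A \<and> f \<in> Hom C X Y \<and>
     (\<forall>W\<in>A. \<forall>g\<in>Hom C W X. \<forall>h\<in>Hom C W X. f \<cdot>\<^bsub>C\<^esub> g = f \<cdot>\<^bsub>C\<^esub> h \<longrightarrow> g = h)"

definition epi_in ::
  "('k, 'o, 'm, 'z) linear_cat_scheme \<Rightarrow> 'o set \<Rightarrow> 'o \<Rightarrow> 'o \<Rightarrow> 'm \<Rightarrow> bool" where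
  "epi_in C A X Y f \<longleftrightarrow> X \<in> A \<and> Y \<in> A \<and> f \<in> Hom C X Y \<and>
     (\<forall>W\<in>A. \<forall>g\<in>Hom C Y W. \<forall>h\<in>Hom C Y W. g \<cdot>\<^bsub>C\<^esub> f = h \<cdot>\<^bsub>C\<^esub> f \<longrightarrow> g = h)"

definition simple_in ::
  "('k, 'o, 'm::zero, 'z) linear_cat_scheme \<Rightarrow> 'o set \<Rightarrow> 'o \<Rightarrow> bool" where
  "simple_in C A S \<longleftrightarrow> S \<in> A \<and> \<not> zero_object C S \<and>
     (\<forall>U f. mono_in C A U S f \<longrightarrow> zero_object C U \<or> is_iso C U S f)"

text \<open>
  In a Hom-finite category a direct sum of nonzero objects has finitely many summands, so finite
  direct sums suffice here.
\<close>

definition semisimple_in ::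
  "('k, 'o, 'm::ab_group_add, 'z) linear_cat_scheme \<Rightarrow> 'o set \<Rightarrow> 'o \<Rightarrow> bool" where
  "semisimple_in C A Q \<longleftrightarrow> Q \<in> A \<and> (\<exists>Ss. (\<forall>S\<in>set Ss. simple_in C A S) \<and> direct_sum C Ss Q)"

text \<open>
  \<open>S\<close> is the largest semisimple quotient of \<open>H\<close>: every semisimple quotient of \<open>H\<close> is a quotient of
  \<open>S\<close>, compatibly with the projections from \<open>H\<close>.
\<close>

definition is_top ::
  "('k, 'o, 'm::ab_group_add, 'z) linear_cat_scheme \<Rightarrow> 'o set \<Rightarrow> 'o \<Rightarrow> 'o \<Rightarrow> bool" where
  "is_top C A H S \<longleftrightarrow> semisimple_in C A S \<and> (\<exists>p. epi_in C A H S p \<and>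
     (\<forall>Q q. semisimple_in C A Q \<longrightarrow> epi_in C A H Q q \<longrightarrow> (\<exists>r\<in>Hom C S Q. q = r \<cdot>\<^bsub>C\<^esub> p)))"

end

theory Submission
  imports Defs
begin

text \<open>
  Let \<open>Z = \<nu>\<^sub>d\<inverse> X'\<close>, which lies in the aisle of \<open>M\<close> because \<open>M\<close> is \<open>d\<close>-silting, and let \<open>X \<rightarrow> X\<^sub>0' \<rightarrow> Y \<rightarrow> X[1]\<close>
  be the exchange triangle.  Long exact sequences reduce condition (1) to \<open>Hom(Y, Z[1]) = 0\<close>, that is, to
  the surjectivity of \<open>Hom(X\<^sub>0', Z) \<rightarrow> Hom(X, Z)\<close>, and Serre duality turns condition (2) into
  \<open>Hom(Z, S) = 0\<close>.  Now \<open>Hom(X', S) = 0\<close>, and \<open>Hom(M, -)\<close> sends nonzero maps from the aisle to simple objects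
  of the heart to surjections; so a nonzero map \<open>Z \<rightarrow> S\<close> yields a map \<open>X \<rightarrow> Z\<close> that does not factor through
  \<open>X\<^sub>0'\<close>.  Conversely, if \<open>Hom(Z, S) = 0\<close>, then the cone \<open>C\<close> of a right \<open>add X'\<close>-approximation of \<open>Z\<close> satisfies
  \<open>Hom(X', C) = 0 = Hom(C, S)\<close>, hence \<open>Hom(X, C) = 0\<close>, as otherwise a simple quotient of \<open>H\<^sup>0 C\<close> would be
  a summand of \<open>S\<close>.
\<close>

section \<open>Linear categories\<close>

text \<open>The development tracks only the vanishing of Hom spaces; it constructs neither an
  abelian structure on the heart nor a triangulated structure on \<nu>. In the heart, Hom(M,-) takes
  over: Hom(M, V[i]) = 0 for V in the heart and i nonzero makes it exact, generation by M makes it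
  detect zero objects, and truncation from the aisle does not change it. Cokernels become truncated
  cones, kernels become fibres, and epimorphisms become maps that are surjective on Hom(M,-). Simple
  quotients exist because a proper quotient needs fewer generators of the finite-dimensional space
  Hom(M,-). The functor \<nu>\<inverse> is moved into the first argument of Hom, where triangles in
  the second argument apply directly; its compatibility with the shift comes from the uniqueness of
  objects corepresenting a dual. Hom-vanishing for the mutation and its d-silting condition are one
  statement about an assignment G, the identity or \<open>\<nu>\<^sub>d\<inverse>\<close>: silting
  resp. d-silting of M forces all positive degrees once Hom(Y, G X'[1]) = 0.\<close>

context linear_category
begin

lemma zero_in_Hom [simp]: "0 \<in> Hom C X Y"
  by (rule subspace_0[OF Hom_subspace])

lemma add_in_Hom: "f \<in> Hom C X Y \<Longrightarrow> g \<in> Hom C X Y \<Longrightarrow> f + g \<in> Hom C X Y"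
  by (rule subspace_add[OF Hom_subspace])

lemma diff_in_Hom: "f \<in> Hom C X Y \<Longrightarrow> g \<in> Hom C X Y \<Longrightarrow> f - g \<in> Hom C X Y"
  by (rule subspace_diff[OF Hom_subspace])

lemma uminus_in_Hom: "f \<in> Hom C X Y \<Longrightarrow> - f \<in> Hom C X Y"
  by (rule subspace_neg[OF Hom_subspace])

lemma scl_in_Hom: "f \<in> Hom C X Y \<Longrightarrow> scl C a f \<in> Hom C X Y"
  by (rule subspace_scale[OF Hom_subspace])

lemma sum_in_Hom: "(\<And>i. i \<in> A \<Longrightarrow> F i \<in> Hom C X Y) \<Longrightarrow> (\<Sum>i\<in>A. F i) \<in> Hom C X Y"
  by (rule subspace_sum[OF Hom_subspace])

lemma comp_zero_right: "g \<in> Hom C Y Z \<Longrightarrow> g \<cdot> 0 = 0"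
  using comp_add_right[of 0 Y Y 0 g Z] by simp

lemma comp_zero_left: "f \<in> Hom C X Y \<Longrightarrow> 0 \<cdot> f = 0"
  using comp_add_left[of f X Y 0 Y 0] by simp

lemma comp_diff_right:
  assumes "f \<in> Hom C X Y" "f' \<in> Hom C X Y" "g \<in> Hom C Y Z"
  shows "g \<cdot> (f - f') = g \<cdot> f - g \<cdot> f'"
  using comp_add_right[OF diff_in_Hom[OF assms(1,2)] assms(2,3)] by (simp add: algebra_simps)

lemma comp_diff_left:
  assumes "f \<in> Hom C X Y" "g \<in> Hom C Y Z" "g' \<in> Hom C Y Z"
  shows "(g - g') \<cdot> f = g \<cdot> f - g' \<cdot> f"
  using comp_add_left[OF assms(1) diff_in_Hom[OF assms(2,3)] assms(3)] by (simp add: algebra_simps)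

lemma comp_uminus_right: "f \<in> Hom C X Y \<Longrightarrow> g \<in> Hom C Y Z \<Longrightarrow> g \<cdot> (- f) = - (g \<cdot> f)"
  using comp_diff_right[of 0 X Y f g Z] by (simp add: comp_zero_right)

lemma comp_uminus_left: "f \<in> Hom C X Y \<Longrightarrow> g \<in> Hom C Y Z \<Longrightarrow> (- g) \<cdot> f = - (g \<cdot> f)"
  using comp_diff_left[of f X Y 0 Z g] by (simp add: comp_zero_left)

lemma comp_sum_right:
  assumes "\<And>i. i \<in> A \<Longrightarrow> F i \<in> Hom C X Y" "g \<in> Hom C Y Z"
  shows "g \<cdot> (\<Sum>i\<in>A. F i) = (\<Sum>i\<in>A. g \<cdot> F i)"
  using assms
proof (induction A rule: infinite_finite_induct)
  case (insert a A)
  then show ?case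
    using comp_add_right[of "F a" X Y "\<Sum>i\<in>A. F i" g Z] sum_in_Hom[of A F X Y] by simp
qed (auto simp: comp_zero_right)

lemma comp_sum_left:
  assumes "\<And>i. i \<in> A \<Longrightarrow> F i \<in> Hom C Y Z" "f \<in> Hom C X Y"
  shows "(\<Sum>i\<in>A. F i) \<cdot> f = (\<Sum>i\<in>A. F i \<cdot> f)"
  using assms
proof (induction A rule: infinite_finite_induct)
  case (insert a A)
  then show ?case
    using comp_add_left[of f X Y "F a" Z "\<Sum>i\<in>A. F i"] sum_in_Hom[of A F Y Z] by simp
qed (auto simp: comp_zero_left)

abbreviation orth :: "'o \<Rightarrow> 'o \<Rightarrow> bool" where
  "orth X Y \<equiv> Hom C X Y = {0}"

lemma orthI: "(\<And>u. u \<in> Hom C X Y \<Longrightarrow> u = 0) \<Longrightarrow> orth X Y"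
  using zero_in_Hom by blast

lemma orth_retract_left:
  assumes i: "i \<in> Hom C X W" and p: "p \<in> Hom C W X" and "p \<cdot> i = Id C X" and "orth W B"
  shows "orth X B"
proof (rule orthI)
  fix u assume u: "u \<in> Hom C X B"
  have "u \<cdot> p = 0"
    using comp_in_Hom[OF p u] assms(4) by simp
  moreover have "u = (u \<cdot> p) \<cdot> i"
    using comp_assoc[OF i p u] assms(3) comp_Id_right[OF u] by simp
  ultimately show "u = 0"
    using comp_zero_left[OF i] by simp
qed

lemma orth_retract_right:
  assumes i: "i \<in> Hom C X W" and p: "p \<in> Hom C W X" and "p \<cdot> i = Id C X" and "orth B W"
  shows "orth B X"
proof (rule orthI)
  fix u assume u: "u \<in> Hom C B X"
  have "i \<cdot> u = 0"
    using comp_in_Hom[OF u i] assms(4) by simp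
  moreover have "u = p \<cdot> (i \<cdot> u)"
    using comp_assoc[OF u i p] assms(3) comp_Id_left[OF u] by simp
  ultimately show "u = 0"
    using comp_zero_right[OF p] by simp
qed

lemma zero_object_iff_Id: "zero_object C X \<longleftrightarrow> Id C X = 0"
proof
  assume "Id C X = 0"
  then have "u = 0" if "u \<in> Hom C X Y" for u Y
    using comp_Id_right[OF that] comp_zero_right[OF that] by simp
  moreover from \<open>Id C X = 0\<close> have "u = 0" if "u \<in> Hom C Y X" for u Y
    using comp_Id_left[OF that] comp_zero_left[OF that] by simp
  ultimately show "zero_object C X"
    unfolding zero_object_def using orthI by simp
qed (use Id_in_Hom in \<open>auto simp: zero_object_def\<close>)

lemma direct_sum_pairE:
  assumes "direct_sum C [X, Y] W"
  obtains i j p q where "i \<in> Hom C X W" "j \<in> Hom C Y W" "p \<in> Hom C W X" "q \<in> Hom C W Y"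
    "p \<cdot> i = Id C X" "q \<cdot> j = Id C Y" "p \<cdot> j = 0" "q \<cdot> i = 0" "i \<cdot> p + j \<cdot> q = Id C W"
proof -
  obtain \<iota> \<pi> where *: "\<forall>i<length [X, Y]. \<iota> i \<in> Hom C ([X, Y] ! i) W \<and> \<pi> i \<in> Hom C W ([X, Y] ! i)"
    "\<forall>i<length [X, Y]. \<forall>j<length [X, Y]. \<pi> i \<cdot> \<iota> j = (if i = j then Id C ([X, Y] ! i) else 0)"
    "(\<Sum>i<length [X, Y]. \<iota> i \<cdot> \<pi> i) = Id C W"
    using assms unfolding direct_sum_def by blast
  show ?thesis
    using *(3) by (intro that[of "\<iota> 0" "\<iota> 1" "\<pi> 0" "\<pi> 1"])
      (use *(1)[rule_format, of 0] *(1)[rule_format, of 1] *(2)[rule_format, of 0 0] *(2)[rule_format, of 0 1]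
         *(2)[rule_format, of 1 0] *(2)[rule_format, of 1 1] in simp_all)
qed

lemma direct_sum_pairI:
  assumes "i \<in> Hom C X W" "j \<in> Hom C Y W" "p \<in> Hom C W X" "q \<in> Hom C W Y"
    "p \<cdot> i = Id C X" "q \<cdot> j = Id C Y" "p \<cdot> j = 0" "q \<cdot> i = 0" "i \<cdot> p + j \<cdot> q = Id C W"
  shows "direct_sum C [X, Y] W"
  unfolding direct_sum_def
  by (rule exI[of _ "\<lambda>n. if n = 0 then i else j"], rule exI[of _ "\<lambda>n. if n = 0 then p else q"])
     (use assms in \<open>simp add: All_less_Suc\<close>)

lemma direct_sum_singleton: "direct_sum C [X] X"
  unfolding direct_sum_def
  by (rule exI[of _ "\<lambda>_. Id C X"], rule exI[of _ "\<lambda>_. Id C X"])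
     (simp add: Id_in_Hom comp_Id_left[OF Id_in_Hom])

lemma direct_sumE:
  assumes "direct_sum C Ys W"
  obtains \<iota> \<pi> where
    "\<And>i. i < length Ys \<Longrightarrow> \<iota> i \<in> Hom C (Ys ! i) W" "\<And>i. i < length Ys \<Longrightarrow> \<pi> i \<in> Hom C W (Ys ! i)"
    "\<And>i. i < length Ys \<Longrightarrow> \<pi> i \<cdot> \<iota> i = Id C (Ys ! i)" "(\<Sum>i<length Ys. \<iota> i \<cdot> \<pi> i) = Id C W"
  using assms unfolding direct_sum_def by (elim exE conjE) (rule that, simp_all)

lemma direct_sum_factor_left:
  assumes \<iota>: "\<And>i. i < n \<Longrightarrow> \<iota> i \<in> Hom C (Ys i) W" and \<pi>: "\<And>i. i < n \<Longrightarrow> \<pi> i \<in> Hom C W (Ys i)"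
    and sum: "(\<Sum>i<n. \<iota> i \<cdot> \<pi> i) = Id C W"
    and u: "u \<in> Hom C W B" and 0: "\<And>i. i < n \<Longrightarrow> u \<cdot> \<iota> i = 0"
  shows "u = 0"
proof -
  have "u = u \<cdot> (\<Sum>i<n. \<iota> i \<cdot> \<pi> i)"
    using comp_Id_right[OF u] sum by simp
  also have "\<dots> = (\<Sum>i<n. u \<cdot> (\<iota> i \<cdot> \<pi> i))"
    by (rule comp_sum_right[OF _ u]) (use comp_in_Hom[OF \<pi> \<iota>] in simp)
  also have "\<dots> = 0"
  proof (rule sum.neutral, intro ballI)
    fix i assume "i \<in> {..<n}"
    then show "u \<cdot> (\<iota> i \<cdot> \<pi> i) = 0"
      using comp_assoc[OF \<pi> \<iota> u, of i] 0[of i] comp_zero_left[OF \<pi>, of i] by simp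
  qed
  finally show ?thesis .
qed

lemma direct_sum_factor_right:
  assumes \<iota>: "\<And>i. i < n \<Longrightarrow> \<iota> i \<in> Hom C (Ys i) W" and \<pi>: "\<And>i. i < n \<Longrightarrow> \<pi> i \<in> Hom C W (Ys i)"
    and sum: "(\<Sum>i<n. \<iota> i \<cdot> \<pi> i) = Id C W"
    and u: "u \<in> Hom C B W" and 0: "\<And>i. i < n \<Longrightarrow> \<pi> i \<cdot> u = 0"
  shows "u = 0"
proof -
  have "u = (\<Sum>i<n. \<iota> i \<cdot> \<pi> i) \<cdot> u"
    using comp_Id_left[OF u] sum by simp
  also have "\<dots> = (\<Sum>i<n. (\<iota> i \<cdot> \<pi> i) \<cdot> u)"
    by (rule comp_sum_left[OF _ u]) (use comp_in_Hom[OF \<pi> \<iota>] in simp)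
  also have "\<dots> = 0"
  proof (rule sum.neutral, intro ballI)
    fix i assume "i \<in> {..<n}"
    then show "(\<iota> i \<cdot> \<pi> i) \<cdot> u = 0"
      using comp_assoc[OF u \<pi> \<iota>, of i] 0[of i] comp_zero_right[OF \<iota>, of i] by simp
  qed
  finally show ?thesis .
qed

lemma direct_sum_nonzero_left:
  assumes "direct_sum C Ys W" "u \<in> Hom C W B" "u \<noteq> 0"
  obtains Y i p where "Y \<in> set Ys" "i \<in> Hom C Y W" "p \<in> Hom C W Y" "p \<cdot> i = Id C Y" "u \<cdot> i \<noteq> 0"
  using assms(1)
proof (rule direct_sumE)
  fix \<iota> \<pi>
  assume *:
    "\<And>i. i < length Ys \<Longrightarrow> \<iota> i \<in> Hom C (Ys ! i) W" "\<And>i. i < length Ys \<Longrightarrow> \<pi> i \<in> Hom C W (Ys ! i)"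
    "\<And>i. i < length Ys \<Longrightarrow> \<pi> i \<cdot> \<iota> i = Id C (Ys ! i)" "(\<Sum>i<length Ys. \<iota> i \<cdot> \<pi> i) = Id C W"
  then obtain n where "n < length Ys" "u \<cdot> \<iota> n \<noteq> 0"
    using direct_sum_factor_left[OF *(1,2,4) assms(2)] assms(3) by metis
  then show ?thesis
    using that[of "Ys ! n" "\<iota> n" "\<pi> n"] * by simp
qed

lemma direct_sum_nonzero_right:
  assumes "direct_sum C Ys W" "u \<in> Hom C B W" "u \<noteq> 0"
  obtains Y i p where "Y \<in> set Ys" "i \<in> Hom C Y W" "p \<in> Hom C W Y" "p \<cdot> i = Id C Y" "p \<cdot> u \<noteq> 0"
  using assms(1)
proof (rule direct_sumE)
  fix \<iota> \<pi>
  assume *: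
    "\<And>i. i < length Ys \<Longrightarrow> \<iota> i \<in> Hom C (Ys ! i) W" "\<And>i. i < length Ys \<Longrightarrow> \<pi> i \<in> Hom C W (Ys ! i)"
    "\<And>i. i < length Ys \<Longrightarrow> \<pi> i \<cdot> \<iota> i = Id C (Ys ! i)" "(\<Sum>i<length Ys. \<iota> i \<cdot> \<pi> i) = Id C W"
  then obtain n where "n < length Ys" "\<pi> n \<cdot> u \<noteq> 0"
    using direct_sum_factor_right[OF *(1,2,4) assms(2)] assms(3) by metis
  then show ?thesis
    using that[of "Ys ! n" "\<iota> n" "\<pi> n"] * by simp
qed

lemma orth_direct_sum_left:
  assumes "direct_sum C Ys W" "\<And>Y. Y \<in> set Ys \<Longrightarrow> orth Y B"
  shows "orth W B"
proof (rule orthI, rule ccontr)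
  fix u assume u: "u \<in> Hom C W B" "u \<noteq> 0"
  then obtain Y i where "Y \<in> set Ys" "i \<in> Hom C Y W" "u \<cdot> i \<noteq> 0"
    using direct_sum_nonzero_left[OF assms(1)] by metis
  then show False
    using assms(2)[of Y] comp_in_Hom[OF _ u(1), of i Y] by simp
qed

lemma orth_direct_sum_right:
  assumes "direct_sum C Ys W" "\<And>Y. Y \<in> set Ys \<Longrightarrow> orth B Y"
  shows "orth B W"
proof (rule orthI, rule ccontr)
  fix u assume u: "u \<in> Hom C B W" "u \<noteq> 0"
  then obtain Y p where "Y \<in> set Ys" "p \<in> Hom C W Y" "p \<cdot> u \<noteq> 0"
    using direct_sum_nonzero_right[OF assms(1)] by metis
  then show False
    using assms(2)[of Y] comp_in_Hom[OF u(1), of p Y] by simp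
qed

lemma orth_pair_left_iff:
  assumes "direct_sum C [X, Y] W"
  shows "orth W B \<longleftrightarrow> orth X B \<and> orth Y B"
proof -
  obtain i j p q where *: "i \<in> Hom C X W" "j \<in> Hom C Y W" "p \<in> Hom C W X" "q \<in> Hom C W Y"
    "p \<cdot> i = Id C X" "q \<cdot> j = Id C Y"
    by (rule direct_sum_pairE[OF assms])
  have "orth X B" "orth Y B" if "orth W B"
    using orth_retract_left[OF _ _ _ that] * by simp_all
  then show ?thesis
    using orth_direct_sum_left[OF assms] by fastforce
qed

lemma orth_pair_right_iff:
  assumes "direct_sum C [X, Y] W"
  shows "orth B W \<longleftrightarrow> orth B X \<and> orth B Y"
proof -
  obtain i j p q where *: "i \<in> Hom C X W" "j \<in> Hom C Y W" "p \<in> Hom C W X" "q \<in> Hom C W Y"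
    "p \<cdot> i = Id C X" "q \<cdot> j = Id C Y"
    by (rule direct_sum_pairE[OF assms])
  have "orth B X" "orth B Y" if "orth B W"
    using orth_retract_right[OF _ _ _ that] * by simp_all
  then show ?thesis
    using orth_direct_sum_right[OF assms] by fastforce
qed

lemma linear_functor_zero:
  assumes "linear_functor C F" shows "mor F 0 = 0"
proof -
  have "mor F (0 + 0) = mor F 0 + mor F 0"
    using assms zero_in_Hom unfolding linear_functor_def by blast
  then show ?thesis by simp
qed

end

context additive_linear_category
begin

lemma self_in_add_closure: "X \<in> add_closure C X"
proof -
  obtain Z where Z: "zero_object C Z"
    using ex_zero_object by blast
  have "direct_sum C [X, Z] X"
    by (rule direct_sum_pairI[of "Id C X" _ _ 0 _ "Id C X" 0])
       (use Z in \<open>auto simp: Id_in_Hom comp_Id_left[OF Id_in_Hom] comp_zero_left[OF Id_in_Hom]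
          comp_zero_right[OF Id_in_Hom] zero_object_iff_Id comp_zero_left[OF zero_in_Hom]\<close>)
  then show ?thesis
    unfolding add_closure_def using direct_sum_singleton[of X]
    by (auto intro!: exI[of _ "1::nat"])
qed

lemma orth_add_closure_left:
  assumes "X0 \<in> add_closure C X" "orth X B" shows "orth X0 B"
proof -
  obtain n W Y where W: "direct_sum C (replicate n X) W" "direct_sum C [X0, Y] W"
    using assms(1) unfolding add_closure_def by blast
  have "orth W B"
    by (rule orth_direct_sum_left[OF W(1)]) (use assms(2) in simp)
  then show ?thesis
    using orth_pair_left_iff[OF W(2)] by blast
qed

lemma orth_add_closure_right:
  assumes "X0 \<in> add_closure C X" "orth B X" shows "orth B X0"
proof -
  obtain n W Y where W: "direct_sum C (replicate n X) W" "direct_sum C [X0, Y] W"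
    using assms(1) unfolding add_closure_def by blast
  have "orth B W"
    by (rule orth_direct_sum_right[OF W(1)]) (use assms(2) in simp)
  then show ?thesis
    using orth_pair_right_iff[OF W(2)] by blast
qed

end

section \<open>Triangulated categories\<close>

context triangulated_category
begin

section \<open>The shift functor and its integer powers\<close>

lemma shm_in_Hom: "f \<in> Hom T X Y \<Longrightarrow> shm T f \<in> Hom T (sh1 T X) (sh1 T Y)"
  using shift_functor unfolding linear_functor_def by blast

lemma shm_Id: "shm T (Id T X) = Id T (sh1 T X)"
  using shift_functor unfolding linear_functor_def by blast

lemma shm_comp: "f \<in> Hom T X Y \<Longrightarrow> g \<in> Hom T Y Z \<Longrightarrow> shm T (g \<cdot> f) = shm T g \<cdot> shm T f"
  using shift_functor unfolding linear_functor_def by blast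

lemma shm_add: "f \<in> Hom T X Y \<Longrightarrow> g \<in> Hom T X Y \<Longrightarrow> shm T (f + g) = shm T f + shm T g"
  using shift_functor unfolding linear_functor_def by blast

lemma shm_scl: "f \<in> Hom T X Y \<Longrightarrow> shm T (scl T a f) = scl T a (shm T f)"
  using shift_functor unfolding linear_functor_def by blast

lemma shm_zero: "shm T 0 = 0"
  by (rule linear_functor_zero[OF shift_functor])

lemma shm_uminus: "f \<in> Hom T X Y \<Longrightarrow> shm T (- f) = - shm T f"
  using shm_add[of f X Y "- f"] uminus_in_Hom[of f X Y] shm_zero by (simp add: eq_neg_iff_add_eq_0 add.commute)

lemma shm_inject: "f \<in> Hom T X Y \<Longrightarrow> g \<in> Hom T X Y \<Longrightarrow> shm T f = shm T g \<longleftrightarrow> f = g"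
  using inj_on_eq_iff[OF bij_betw_imp_inj_on[OF shift_bij_mor[of X Y]]] .

lemma shmE:
  assumes "u \<in> Hom T (sh1 T X) (sh1 T Y)"
  obtains f where "f \<in> Hom T X Y" "u = shm T f"
  using assms bij_betw_imp_surj_on[OF shift_bij_mor[of X Y]] by blast

lemma sh1_inv: "sh1 T (inv (sh1 T) X) = X"
  using shift_bij_ob by (simp add: bij_is_surj surj_f_inv_f)

lemma inv_sh1: "inv (sh1 T) (sh1 T X) = X"
  using shift_bij_ob by (simp add: bij_is_inj)

lemma sh_0 [simp]: "sh T 0 X = X"
  by (simp add: sh_def)

lemma sh_succ: "sh T (i + 1) X = sh1 T (sh T i X)"
proof (cases "0 \<le> i")
  case True
  then show ?thesis by (simp add: sh_def nat_add_distrib)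
next
  case False
  then obtain n where "i = - int (Suc n)"
    by (metis int_cases of_nat_0_le_iff)
  then show ?thesis
    by (cases n) (simp_all add: sh_def sh1_inv nat_add_distrib)
qed

lemma sh_1: "sh T 1 X = sh1 T X"
  using sh_succ[of 0 X] by simp

lemma sh_add: "sh T (i + j) X = sh T i (sh T j X)"
proof (induction i rule: int_induct[of _ 0])
  case (step1 i)
  then show ?case
    using sh_succ[of "i + j" X] sh_succ[of i "sh T j X"] by (simp add: algebra_simps)
next
  case (step2 i)
  have "sh1 T (sh T (i - 1 + j) X) = sh1 T (sh T (i - 1) (sh T j X))"
    using step2 sh_succ[of "i - 1 + j" X] sh_succ[of "i - 1" "sh T j X"] by (simp add: algebra_simps)
  then show ?case
    using inv_sh1 by metis
qed simp

lemma sh_sh1: "sh T i (sh1 T X) = sh T (i + 1) X"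
  using sh_add[of i 1 X] by (simp add: sh_1)

lemma orth_sh1: "orth (sh1 T X) (sh1 T Y) \<longleftrightarrow> orth X Y"
proof
  assume "orth X Y"
  then show "orth (sh1 T X) (sh1 T Y)"
    using bij_betw_imp_surj_on[OF shift_bij_mor[of X Y]] shm_zero by simp
next
  assume "orth (sh1 T X) (sh1 T Y)"
  then show "orth X Y"
    using shm_in_Hom[of _ X Y] shm_inject[of _ X Y 0] shm_zero by (intro orthI) auto
qed

lemma orth_sh: "orth (sh T n X) (sh T n Y) \<longleftrightarrow> orth X Y"
proof (induction n rule: int_induct[of _ 0])
  case (step1 i)
  then show ?case by (simp add: sh_succ orth_sh1)
next
  case (step2 i)
  then show ?case
    using orth_sh1[of "sh T (i - 1) X" "sh T (i - 1) Y"] sh_succ[of "i - 1"] by simp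
qed simp

lemma orth_sh_move: "orth X (sh T n Y) \<longleftrightarrow> orth (sh T (- n) X) Y"
  using orth_sh[of n "sh T (- n) X" Y] by (simp flip: sh_add)

lemma zero_object_sh1: "zero_object T X \<Longrightarrow> zero_object T (sh1 T X)"
  by (simp add: zero_object_iff_Id shm_zero flip: shm_Id)

section \<open>Rotation of triangles and exactness of Hom\<close>

lemma dist_rot: "dist T X Y Z f g h \<Longrightarrow> dist T Y Z (sh1 T X) g h (- shm T f)"
  using dist_rotate dist_in_Hom by blast

lemma dist_unrot:
  assumes "dist T Y Z (sh1 T X) g h k"
  obtains f where "f \<in> Hom T X Y" "dist T X Y Z f g h" "k = - shm T f"
proof -
  have m: "g \<in> Hom T Y Z" "h \<in> Hom T Z (sh1 T X)" "k \<in> Hom T (sh1 T X) (sh1 T Y)"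
    using dist_in_Hom[OF assms] by auto
  obtain f where f: "f \<in> Hom T X Y" "k = shm T f"
    using m(3) by (rule shmE)
  \<comment> \<open>Rotation negates the last map, so the map to be recovered is the negative of the
    preimage of \<open>k\<close>.\<close>
  have *: "- f \<in> Hom T X Y" "k = - shm T (- f)"
    using f uminus_in_Hom shm_uminus by auto
  then have "dist T X Y Z (- f) g h"
    using dist_rotate m(1,2) assms by metis
  then show ?thesis
    using that * by blast
qed

text \<open>The identity triangle on \<open>X\<close> maps to the given one by \<open>Id\<close> and
  \<open>f\<close>; the third component starts at a zero object, and commutativity reads
  \<open>c \<cdot> 0 = g \<cdot> f\<close>.\<close>

lemma dist_comp_zero:
  assumes "dist T X Y Z f g h" shows "g \<cdot> f = 0"
proof -
  have m: "f \<in> Hom T X Y"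
    using dist_in_Hom[OF assms] by auto
  obtain K where K: "zero_object T K"
    using ex_zero_object by blast
  obtain c where "c \<in> Hom T K Z" "c \<cdot> 0 = g \<cdot> f"
    using dist_morphism[OF dist_Id[OF K] assms Id_in_Hom m] by blast
  then show ?thesis
    using comp_zero_right by metis
qed

lemma dist_comp_zero2: "dist T X Y Z f g h \<Longrightarrow> h \<cdot> g = 0"
  by (rule dist_comp_zero[OF dist_rot])

lemma dist_comp_zero3:
  assumes "dist T X Y Z f g h" shows "shm T f \<cdot> h = 0"
proof -
  have m: "f \<in> Hom T X Y" "h \<in> Hom T Z (sh1 T X)"
    using dist_in_Hom[OF assms] by auto
  show ?thesis
    using dist_comp_zero[OF dist_rot[OF dist_rot[OF assms]]] comp_uminus_left[OF m(2) shm_in_Hom[OF m(1)]]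
    by simp
qed

text \<open>Mapping the rotated identity triangle W \<rightarrow> 0 \<rightarrow> W[1] to the
  rotated triangle yields W[1] \<rightarrow> X[1]. The shift is full, so this is the shift of a map
  W \<rightarrow> X, and faithfulness gives the factorization; the two signs cancel.\<close>

lemma dist_lift:
  assumes D: "dist T X Y Z f g h" and u: "u \<in> Hom T W Y" and 0: "g \<cdot> u = 0"
  obtains v where "v \<in> Hom T W X" "u = f \<cdot> v"
proof -
  have m: "f \<in> Hom T X Y" "g \<in> Hom T Y Z" "h \<in> Hom T Z (sh1 T X)"
    using dist_in_Hom[OF D] by auto
  obtain K where K: "zero_object T K"
    using ex_zero_object by blast
  obtain c where c: "c \<in> Hom T (sh1 T W) (sh1 T X)"
    "shm T u \<cdot> (- shm T (Id T W)) = - shm T f \<cdot> c"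
    using dist_morphism[OF dist_rot[OF dist_Id[OF K]] dist_rot[OF D] u zero_in_Hom] 0
      comp_zero_left[OF zero_in_Hom] by metis
  obtain v where v: "v \<in> Hom T W X" "c = shm T v"
    using c(1) by (rule shmE)
  have "- shm T u = - shm T (f \<cdot> v)"
    using c v m(1) u comp_uminus_right[OF Id_in_Hom shm_in_Hom[OF u]]
    by (simp add: shm_Id comp_Id_right[OF shm_in_Hom[OF u]] shm_comp[OF v(1) m(1)]
        comp_uminus_left[OF shm_in_Hom[OF v(1)] shm_in_Hom[OF m(1)]])
  then have "u = f \<cdot> v"
    using shm_inject[OF u comp_in_Hom[OF v(1) m(1)]] by simp
  then show ?thesis
    using that v(1) by blast
qed

text \<open>Dual to \<open>dist_lift\<close>: the given triangle is mapped to 0 \<rightarrow> W = W,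
  which is the identity triangle rotated backwards.\<close>

lemma dist_extend:
  assumes D: "dist T X Y Z f g h" and u: "u \<in> Hom T Y W" and 0: "u \<cdot> f = 0"
  obtains v where "v \<in> Hom T Z W" "u = v \<cdot> g"
proof -
  obtain K where K: "zero_object T K"
    using ex_zero_object by blast
  have "dist T W W (sh1 T K) (Id T W) 0 (- shm T 0)"
    using dist_Id[OF zero_object_sh1[OF K]] shm_zero by simp
  then have "dist T K W W 0 (Id T W) 0"
    using dist_rotate[OF zero_in_Hom Id_in_Hom zero_in_Hom] by blast
  then obtain c where "c \<in> Hom T Z W" "c \<cdot> g = Id T W \<cdot> u"
    using dist_morphism[OF D _ zero_in_Hom u] 0 comp_zero_left[OF zero_in_Hom] by metis
  then show ?thesis
    using that comp_Id_left[OF u] by metis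
qed

lemma dist_lift2:
  assumes "dist T X Y Z f g h" "u \<in> Hom T W Z" "h \<cdot> u = 0"
  obtains v where "v \<in> Hom T W Y" "u = g \<cdot> v"
  using dist_lift[OF dist_rot[OF assms(1)] assms(2,3)] .

lemma dist_extend2:
  assumes "dist T X Y Z f g h" "u \<in> Hom T Z W" "u \<cdot> g = 0"
  obtains v where "v \<in> Hom T (sh1 T X) W" "u = v \<cdot> h"
  using dist_extend[OF dist_rot[OF assms(1)] assms(2,3)] .

lemma dist_orth_right_mid:
  assumes D: "dist T X Y Z f g h" and "orth W X" "orth W Z" shows "orth W Y"
proof (rule orthI)
  fix u assume u: "u \<in> Hom T W Y"
  have m: "f \<in> Hom T X Y" "g \<in> Hom T Y Z"
    using dist_in_Hom[OF D] by auto
  have "g \<cdot> u = 0"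
    using comp_in_Hom[OF u m(2)] assms(3) by simp
  then obtain v where "v \<in> Hom T W X" "u = f \<cdot> v"
    using dist_lift[OF D u] by blast
  then show "u = 0"
    using assms(2) comp_zero_right[OF m(1)] by simp
qed

lemma dist_orth_left_mid:
  assumes D: "dist T X Y Z f g h" and "orth X W" "orth Z W" shows "orth Y W"
proof (rule orthI)
  fix u assume u: "u \<in> Hom T Y W"
  have m: "f \<in> Hom T X Y" "g \<in> Hom T Y Z"
    using dist_in_Hom[OF D] by auto
  have "u \<cdot> f = 0"
    using comp_in_Hom[OF m(1) u] assms(2) by simp
  then obtain v where "v \<in> Hom T Z W" "u = v \<cdot> g"
    using dist_extend[OF D u] by blast
  then show "u = 0"
    using assms(3) comp_zero_left[OF m(2)] by simp
qed

lemma dist_sh1: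
  "dist T X Y Z f g h \<Longrightarrow>
    dist T (sh1 T X) (sh1 T Y) (sh1 T Z) (- shm T f) (- shm T g) (- shm T h)"
  by (intro dist_rot)

text \<open>The maps stay existential: shifting changes their signs, and only vanishing of Hom
  spaces is read off from the shifted triangle.\<close>

lemma dist_sh_ex:
  assumes "dist T X Y Z f g h"
  shows "\<exists>f g h. dist T (sh T n X) (sh T n Y) (sh T n Z) f g h"
proof (induction n rule: int_induct[of _ 0])
  case base
  then show ?case using assms by auto
next
  case (step1 i)
  then show ?case
    using dist_sh1 by (simp add: sh_succ) blast
next
  case (step2 i)
  then obtain f g h where "dist T (sh1 T (sh T (i - 1) X)) (sh1 T (sh T (i - 1) Y)) (sh1 T (sh T (i - 1) Z)) f g h"
    by (auto simp flip: sh_succ)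
  then show ?case
    by (metis dist_unrot)
qed

text \<open>Three consecutive places of the long exact sequence of Hom(W,-): a term vanishes when
  both its neighbours do.\<close>

lemma dist_sh_orth_right:
  assumes D: "dist T X Y Z f g h"
  shows "orth W (sh T n X) \<Longrightarrow> orth W (sh T n Z) \<Longrightarrow> orth W (sh T n Y)"
    and "orth W (sh T n Y) \<Longrightarrow> orth W (sh T (n + 1) X) \<Longrightarrow> orth W (sh T n Z)"
    and "orth W (sh T n Z) \<Longrightarrow> orth W (sh T (n + 1) Y) \<Longrightarrow> orth W (sh T (n + 1) X)"
proof -
  obtain f' g' h' where D': "dist T (sh T n X) (sh T n Y) (sh T n Z) f' g' h'"
    using dist_sh_ex[OF D] by blast
  show "orth W (sh T n X) \<Longrightarrow> orth W (sh T n Z) \<Longrightarrow> orth W (sh T n Y)"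
    by (rule dist_orth_right_mid[OF D'])
  show "orth W (sh T n Y) \<Longrightarrow> orth W (sh T (n + 1) X) \<Longrightarrow> orth W (sh T n Z)"
    using dist_orth_right_mid[OF dist_rot[OF D']] by (simp add: sh_succ)
  show "orth W (sh T n Z) \<Longrightarrow> orth W (sh T (n + 1) Y) \<Longrightarrow> orth W (sh T (n + 1) X)"
    using dist_orth_right_mid[OF dist_rot[OF dist_rot[OF D']]] by (simp add: sh_succ)
qed

lemma dist_zero_first_iso:
  assumes D: "dist T K Y Z f g h" and K: "zero_object T K"
  obtains s where "s \<in> Hom T Z Y" "s \<cdot> g = Id T Y" "g \<cdot> s = Id T Z"
proof -
  have m: "f \<in> Hom T K Y" "g \<in> Hom T Y Z" "h \<in> Hom T Z (sh1 T K)"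
    using dist_in_Hom[OF D] by auto
  have 0: "f = 0" "h = 0"
    using m K zero_object_sh1[OF K] unfolding zero_object_def by auto
  obtain v where v: "v \<in> Hom T Z Y" "Id T Y = v \<cdot> g"
    using dist_extend[OF D Id_in_Hom] comp_Id_left[OF m(1)] 0(1) by metis
  obtain w where w: "w \<in> Hom T Z Y" "Id T Z = g \<cdot> w"
    using dist_lift2[OF D Id_in_Hom] comp_Id_right[OF m(3)] 0(2) by metis
  have "v = (v \<cdot> g) \<cdot> w"
    using comp_assoc[OF w(1) m(2) v(1)] w(2) comp_Id_right[OF v(1)] by simp
  then have "v = w"
    using v(2) comp_Id_left[OF w(1)] by simp
  then show ?thesis
    using that v w by metis
qed

text \<open>\<open>shm T i\<close> is a split monomorphism that kills \<open>h\<close> on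
  composition.\<close>

lemma retract_dist:
  assumes i: "i \<in> Hom T Q W" and p: "p \<in> Hom T W Q" and pi: "p \<cdot> i = Id T Q"
    and D: "dist T Q W C i g h"
  shows "h = 0"
proof -
  have m: "g \<in> Hom T W C" "h \<in> Hom T C (sh1 T Q)"
    using dist_in_Hom[OF D] by auto
  have "h = (shm T p \<cdot> shm T i) \<cdot> h"
    using comp_Id_left[OF m(2)] by (simp add: pi shm_Id flip: shm_comp[OF i p])
  also have "\<dots> = shm T p \<cdot> (shm T i \<cdot> h)"
    by (rule comp_assoc[OF m(2) shm_in_Hom[OF i] shm_in_Hom[OF p]])
  finally show "h = 0"
    using dist_comp_zero3[OF D] comp_zero_right[OF shm_in_Hom[OF p]] by simp
qed

text \<open>The cone of a split monomorphism is a complement: its connecting map is zero, so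
  \<open>g\<close> has a section.\<close>

lemma retract_complement:
  assumes i: "i \<in> Hom T Q W" and p: "p \<in> Hom T W Q" and pi: "p \<cdot> i = Id T Q"
  shows "\<exists>C. direct_sum T [Q, C] W"
proof -
  obtain C g h where D: "dist T Q W C i g h"
    using ex_cone[OF i] by blast
  have g: "g \<in> Hom T W C"
    using dist_in_Hom[OF D] by auto
  have gi: "g \<cdot> i = 0"
    by (rule dist_comp_zero[OF D])
  obtain s where s: "s \<in> Hom T C W" "Id T C = g \<cdot> s"
    using dist_lift2[OF D Id_in_Hom] retract_dist[OF i p pi D] comp_zero_left[OF Id_in_Hom] by metis
  \<comment> \<open>Removing the component along \<open>Q\<close> makes \<open>p\<close> vanish on
    the section and keeps it a section, because \<open>g \<cdot> i = 0\<close>.\<close>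
  define s' where "s' = s - i \<cdot> (p \<cdot> s)"
  have ps: "p \<cdot> s \<in> Hom T C Q" and ips: "i \<cdot> (p \<cdot> s) \<in> Hom T C W"
    using comp_in_Hom s(1) i p by blast+
  have s': "s' \<in> Hom T C W"
    unfolding s'_def by (rule diff_in_Hom[OF s(1) ips])
  have gs': "g \<cdot> s' = Id T C"
    unfolding s'_def using comp_diff_right[OF s(1) ips g] comp_assoc[OF ps i g] gi
      comp_zero_left[OF ps] s(2) by simp
  have ps': "p \<cdot> s' = 0"
    unfolding s'_def using comp_diff_right[OF s(1) ips p] comp_assoc[OF ps i p] pi
      comp_Id_left[OF ps] by simp
  have ip: "i \<cdot> p \<in> Hom T W W" and sg: "s' \<cdot> g \<in> Hom T W W"
    using comp_in_Hom i p g s' by blast+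
  \<comment> \<open>The error in the biproduct identity. It is killed by \<open>g\<close>, so it
    factors through \<open>i\<close>; it is killed by \<open>p\<close>, so that factor is
    zero.\<close>
  define u where "u = Id T W - i \<cdot> p - s' \<cdot> g"
  have u: "u \<in> Hom T W W"
    unfolding u_def by (intro diff_in_Hom Id_in_Hom ip sg)
  have "g \<cdot> u = g - (g \<cdot> i) \<cdot> p - (g \<cdot> s') \<cdot> g"
    unfolding u_def using comp_diff_right[OF diff_in_Hom[OF Id_in_Hom ip] sg g]
      comp_diff_right[OF Id_in_Hom ip g] comp_Id_right[OF g] comp_assoc[OF p i g] comp_assoc[OF g s' g]
    by simp
  then have "g \<cdot> u = 0"
    using gi gs' comp_zero_left[OF p] comp_Id_left[OF g] by simp
  then obtain v where v: "v \<in> Hom T W Q" "u = i \<cdot> v"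
    using dist_lift[OF D u] by blast
  have "p \<cdot> u = p - (p \<cdot> i) \<cdot> p - (p \<cdot> s') \<cdot> g"
    unfolding u_def using comp_diff_right[OF diff_in_Hom[OF Id_in_Hom ip] sg p]
      comp_diff_right[OF Id_in_Hom ip p] comp_Id_right[OF p] comp_assoc[OF p i p] comp_assoc[OF g s' p]
    by simp
  then have "p \<cdot> u = 0"
    using pi ps' comp_zero_left[OF g] comp_Id_left[OF p] by simp
  then have "v = 0"
    using comp_assoc[OF v(1) i p] pi v comp_Id_left[OF v(1)] by simp
  then have "i \<cdot> p + s' \<cdot> g = Id T W"
    using v(2) comp_zero_right[OF i] by (simp add: u_def algebra_simps)
  then show ?thesis
    using direct_sum_pairI[OF i s' p g pi gs' ps' gi] by blast
qed

text \<open>A thick subcategory is by definition closed only under the first summand of a pair; a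
  retract can always be put in that place.\<close>

lemma thick_retract:
  assumes "thick_subcategory T A" "W \<in> A"
    and "i \<in> Hom T Q W" "p \<in> Hom T W Q" "p \<cdot> i = Id T Q"
  shows "Q \<in> A"
  using assms(1,2) retract_complement[OF assms(3-5)] unfolding thick_subcategory_def by blast

lemma thick_cone: "thick_subcategory T A \<Longrightarrow> dist T X Y Z f g h \<Longrightarrow> X \<in> A \<Longrightarrow> Y \<in> A \<Longrightarrow> Z \<in> A"
  unfolding thick_subcategory_def by blast

lemma thick_sh1: "thick_subcategory T A \<Longrightarrow> sh1 T X \<in> A \<longleftrightarrow> X \<in> A"
  unfolding thick_subcategory_def by blast

lemma thick_fibre: "thick_subcategory T A \<Longrightarrow> dist T X Y Z f g h \<Longrightarrow> Y \<in> A \<Longrightarrow> Z \<in> A \<Longrightarrow> X \<in> A"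
  using thick_cone[OF _ dist_rot] thick_sh1 by blast

text \<open>The cone \<open>C\<close> of the inclusion X \<rightarrow> W is a retract of
  \<open>Y\<close>, via \<open>v\<close> and \<open>g \<cdot> j\<close>. Then W[1] is a cone of a
  map C \<rightarrow> X[1] between objects of \<open>A\<close>.\<close>

lemma thick_direct_sum_pair:
  assumes A: "thick_subcategory T A" and W: "direct_sum T [X, Y] W" and XY: "X \<in> A" "Y \<in> A"
  shows "W \<in> A"
proof -
  obtain i j p q where m: "i \<in> Hom T X W" "j \<in> Hom T Y W" "p \<in> Hom T W X" "q \<in> Hom T W Y"
    and eq: "p \<cdot> i = Id T X" "q \<cdot> j = Id T Y" "q \<cdot> i = 0" "i \<cdot> p + j \<cdot> q = Id T W"
    by (rule direct_sum_pairE[OF W])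
  obtain C g h where D: "dist T X W C i g h"
    using ex_cone[OF m(1)] by blast
  have g: "g \<in> Hom T W C"
    using dist_in_Hom[OF D] by auto
  have gi: "g \<cdot> i = 0"
    by (rule dist_comp_zero[OF D])
  have h: "h = 0"
    by (rule retract_dist[OF m(1,3) eq(1) D])
  obtain v where v: "v \<in> Hom T C Y" "q = v \<cdot> g"
    using dist_extend[OF D m(4) eq(3)] by blast
  obtain s where s: "s \<in> Hom T C W" "Id T C = g \<cdot> s"
    using dist_lift2[OF D Id_in_Hom] h comp_zero_left[OF Id_in_Hom] by metis
  have gj: "g \<cdot> j \<in> Hom T Y C"
    by (rule comp_in_Hom[OF m(2) g])
  have "g = g \<cdot> (i \<cdot> p) + g \<cdot> (j \<cdot> q)"
    using comp_add_right[OF comp_in_Hom[OF m(3,1)] comp_in_Hom[OF m(4,2)] g] eq(4) comp_Id_right[OF g]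
    by simp
  also have "g \<cdot> (i \<cdot> p) = 0"
    using comp_assoc[OF m(3,1) g] gi comp_zero_left[OF m(3)] by simp
  also have "g \<cdot> (j \<cdot> q) = ((g \<cdot> j) \<cdot> v) \<cdot> g"
    using comp_assoc[OF m(4,2) g] comp_assoc[OF g v(1) gj] v(2) by simp
  finally have *: "((g \<cdot> j) \<cdot> v) \<cdot> g = g"
    by simp
  have "(g \<cdot> j) \<cdot> v = ((g \<cdot> j) \<cdot> v) \<cdot> (g \<cdot> s)"
    using comp_Id_right[OF comp_in_Hom[OF v(1) gj]] s(2) by simp
  also have "\<dots> = Id T C"
    using comp_assoc[OF s(1) g comp_in_Hom[OF v(1) gj]] * s(2) by simp
  finally have "C \<in> A"
    using thick_retract[OF A XY(2) v(1) gj] by blast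
  then have "sh1 T W \<in> A"
    using thick_cone[OF A dist_rot[OF dist_rot[OF D]]] thick_sh1[OF A] XY(1) by blast
  then show ?thesis
    using thick_sh1[OF A] by blast
qed

text \<open>The induction carries no partial direct sums inside \<open>W\<close>, only the fact that
  the partial sum of the idempotents \<open>\<iota> i \<cdot> \<pi> i\<close> factors through an
  object of \<open>A\<close>. For the full sum this makes \<open>W\<close> a retract of such an
  object.\<close>

lemma thick_direct_sum:
  assumes A: "thick_subcategory T A" and W: "direct_sum T Ys W" and Ys: "\<And>Y. Y \<in> set Ys \<Longrightarrow> Y \<in> A"
  shows "W \<in> A"
  using W
proof (rule direct_sumE)
  fix \<iota> \<pi>
  assume *: "\<And>i. i < length Ys \<Longrightarrow> \<iota> i \<in> Hom T (Ys ! i) W"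
    "\<And>i. i < length Ys \<Longrightarrow> \<pi> i \<in> Hom T W (Ys ! i)"
    "(\<Sum>i<length Ys. \<iota> i \<cdot> \<pi> i) = Id T W"
  have "\<exists>V\<in>A. \<exists>a\<in>Hom T W V. \<exists>b\<in>Hom T V W. b \<cdot> a = (\<Sum>i<n. \<iota> i \<cdot> \<pi> i)" if "n \<le> length Ys" for n
    using that
  proof (induction n)
    case 0
    obtain V where V: "zero_object T V"
      using ex_zero_object by blast
    then have "V \<in> A"
      using A unfolding thick_subcategory_def by blast
    then show ?case
      by (intro bexI[of _ V] bexI[of _ 0]) (simp_all add: comp_zero_left[OF zero_in_Hom])
  next
    case (Suc n)
    then obtain V a b where V: "V \<in> A" "a \<in> Hom T W V" "b \<in> Hom T V W" "b \<cdot> a = (\<Sum>i<n. \<iota> i \<cdot> \<pi> i)"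
      by auto
    have n: "\<iota> n \<in> Hom T (Ys ! n) W" "\<pi> n \<in> Hom T W (Ys ! n)" "Ys ! n \<in> A"
      using Suc.prems * Ys by auto
    obtain U where U: "direct_sum T [V, Ys ! n] U"
      using ex_direct_sum by blast
    then have UA: "U \<in> A"
      using thick_direct_sum_pair[OF A] V(1) n(3) by blast
    obtain i j p q where m: "i \<in> Hom T V U" "j \<in> Hom T (Ys ! n) U" "p \<in> Hom T U V" "q \<in> Hom T U (Ys ! n)"
      and eq: "p \<cdot> i = Id T V" "q \<cdot> j = Id T (Ys ! n)" "p \<cdot> j = 0" "q \<cdot> i = 0"
      by (rule direct_sum_pairE[OF U])
    define a' where "a' = i \<cdot> a + j \<cdot> \<pi> n"
    define b' where "b' = b \<cdot> p + \<iota> n \<cdot> q"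
    have c: "i \<cdot> a \<in> Hom T W U" "j \<cdot> \<pi> n \<in> Hom T W U" "b \<cdot> p \<in> Hom T U W" "\<iota> n \<cdot> q \<in> Hom T U W"
      using comp_in_Hom m V n by blast+
    have a': "a' \<in> Hom T W U" and b': "b' \<in> Hom T U W"
      unfolding a'_def b'_def using add_in_Hom c by blast+
    have "p \<cdot> a' = a"
      unfolding a'_def using comp_add_right[OF c(1,2) m(3)] comp_assoc[OF V(2) m(1,3)]
        comp_assoc[OF n(2) m(2,3)] eq comp_Id_left[OF V(2)] comp_zero_left[OF n(2)] by simp
    moreover have "q \<cdot> a' = \<pi> n"
      unfolding a'_def using comp_add_right[OF c(1,2) m(4)] comp_assoc[OF V(2) m(1,4)]
        comp_assoc[OF n(2) m(2,4)] eq comp_Id_left[OF n(2)] comp_zero_left[OF V(2)] by simp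
    ultimately have "b' \<cdot> a' = b \<cdot> a + \<iota> n \<cdot> \<pi> n"
      unfolding b'_def using comp_add_left[OF a' c(3,4)] comp_assoc[OF a' m(3) V(3)]
        comp_assoc[OF a' m(4) n(1)] by simp
    then have "b' \<cdot> a' = (\<Sum>i<Suc n. \<iota> i \<cdot> \<pi> i)"
      using V(4) by simp
    then show ?case
      using UA a' b' by blast
  qed
  from this[OF le_refl] obtain V a b where "V \<in> A" "a \<in> Hom T W V" "b \<in> Hom T V W" "b \<cdot> a = Id T W"
    unfolding *(3) by blast
  then show ?thesis
    using thick_retract[OF A] by blast
qed

lemma thick_add_closure:
  assumes A: "thick_subcategory T A" and X: "X \<in> A" and "X0 \<in> add_closure T X"
  shows "X0 \<in> A"
proof -
  obtain n W Y where W: "direct_sum T (replicate n X) W" "direct_sum T [X0, Y] W"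
    using assms(3) unfolding add_closure_def by blast
  have "W \<in> A"
    by (rule thick_direct_sum[OF A W(1)]) (use X in simp)
  then show ?thesis
    using W(2) A unfolding thick_subcategory_def by blast
qed

text \<open>The objects with no maps to any shift of \<open>W\<close> form a thick subcategory
  containing \<open>M\<close>. It is everything, so it contains \<open>W\<close>, whose identity is
  then zero.\<close>

lemma orth_generator_zero:
  assumes "thick T M = UNIV" "\<And>i. orth M (sh T i W)"
  shows "zero_object T W"
proof -
  let ?A = "{U. \<forall>i. orth U (sh T i W)}"
  have "thick_subcategory T ?A"
    unfolding thick_subcategory_def mem_Collect_eq
  proof (intro conjI allI impI)
    fix U i assume "zero_object T U"
    then show "orth U (sh T i W)"
      unfolding zero_object_def by blast
  next
    fix U
    have "orth (sh1 T U) (sh T (i + 1) W) \<longleftrightarrow> orth U (sh T i W)" for i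
      using orth_sh1 by (simp add: sh_succ)
    then show "(\<forall>i. orth (sh1 T U) (sh T i W)) \<longleftrightarrow> (\<forall>i. orth U (sh T i W))"
      by (metis diff_add_cancel)
  next
    fix X Y Z f g h i
    assume D: "dist T X Y Z f g h" and *: "\<forall>i. orth X (sh T i W)" "\<forall>i. orth Y (sh T i W)"
    have "orth (sh1 T X) (sh T (i - 1 + 1) W)"
      using *(1) orth_sh1 sh_succ by metis
    then show "orth Z (sh T i W)"
      using dist_orth_left_mid[OF dist_rot[OF D]] *(2) by simp
  next
    fix X Y V i
    assume "direct_sum T [X, Y] V" "\<forall>i. orth V (sh T i W)"
    then show "orth X (sh T i W)"
      using orth_pair_left_iff by blast
  qed
  then have "thick T M \<subseteq> ?A"
    unfolding thick_def using assms(2) by blast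
  then have "orth W (sh T 0 W)"
    using assms(1) by blast
  then show ?thesis
    using Id_in_Hom[of W] zero_object_iff_Id by simp
qed

end

section \<open>Serre functors\<close>

context linear_category
begin

lemma dual_trivial_imp_trivial:
  assumes V: "subspace V" and "\<And>\<phi>. \<phi> \<in> dual C V \<Longrightarrow> \<phi> = (\<lambda>_. 0)"
  shows "V = {0}"
proof (rule ccontr)
  assume "V \<noteq> {0}"
  then obtain v where v: "v \<in> V" "v \<noteq> 0"
    using subspace_0[OF V] by blast
  interpret k: vector_space "(*) :: 'k \<Rightarrow> 'k \<Rightarrow> 'k"
    by unfold_locales (auto simp: algebra_simps)
  interpret vector_space_pair "scl C" "(*) :: 'k \<Rightarrow> 'k \<Rightarrow> 'k" ..
  have "independent {v}"
    using v(2) by simp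
  then obtain \<phi> where \<phi>: "Vector_Spaces.linear (scl C) (*) \<phi>" "\<phi> v = 1"
    using linear_independent_extend[of "{v}" "\<lambda>_. 1"] by auto
  interpret \<phi>: Vector_Spaces.linear "scl C" "(*)" \<phi>
    by (rule \<phi>(1))
  \<comment> \<open>Elements of \<open>dual\<close> are zero off \<open>V\<close>, so the globally
    linear extension has to be cut down again.\<close>
  have "(\<lambda>x. if x \<in> V then \<phi> x else 0) \<in> dual C V"
    unfolding dual_def using V
    by (auto simp: \<phi>.add \<phi>.scale subspace_add subspace_scale)
  from assms(2)[OF this] have "(if v \<in> V then \<phi> v else 0) = 0"
    by metis
  then show False
    using v \<phi>(2) by simp
qed

lemma linear_functor_in_Hom:
  "linear_functor C F \<Longrightarrow> f \<in> Hom C X Y \<Longrightarrow> mor F f \<in> Hom C (ob F X) (ob F Y)"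
  unfolding linear_functor_def by simp

text \<open>The vanishing form of Hom(A, G B) = Hom(F A, B). Instead of an adjunction it uses that
  both functors are faithful, by naturality of \<alpha> and \<beta>, and that \<open>A\<close> and
  \<open>B\<close> are retracts of their round trips and conversely.\<close>

lemma quasi_inverse_orth:
  assumes "quasi_inverse C F G"
  shows "orth A (ob G B) \<longleftrightarrow> orth (ob F A) B"
proof -
  have FG: "linear_functor C F" "linear_functor C G"
    using assms unfolding quasi_inverse_def by auto
  note F = linear_functor_in_Hom[OF FG(1)] and G = linear_functor_in_Hom[OF FG(2)]
  have F0: "mor F 0 = 0" and G0: "mor G 0 = 0"
    by (simp_all add: linear_functor_zero FG)
  have "comp_iso_identity C G F" "comp_iso_identity C F G"
    using assms unfolding quasi_inverse_def by auto
  then obtain \<alpha> \<beta> where \<alpha>: "\<forall>X. is_iso C (ob G (ob F X)) X (\<alpha> X)"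
    "\<forall>X Y. \<forall>f\<in>Hom C X Y. f \<cdot> \<alpha> X = \<alpha> Y \<cdot> mor G (mor F f)"
    and \<beta>: "\<forall>X. is_iso C (ob F (ob G X)) X (\<beta> X)"
    "\<forall>X Y. \<forall>f\<in>Hom C X Y. f \<cdot> \<beta> X = \<beta> Y \<cdot> mor F (mor G f)"
    unfolding comp_iso_identity_def by (elim exE conjE) (rule that)
  note \<alpha> = \<alpha>(1)[rule_format] \<alpha>(2)[rule_format] and \<beta> = \<beta>(1)[rule_format] \<beta>(2)[rule_format]
  obtain \<alpha>' where \<alpha>': "\<alpha> A \<in> Hom C (ob G (ob F A)) A" "\<alpha>' \<in> Hom C A (ob G (ob F A))" "\<alpha> A \<cdot> \<alpha>' = Id C A"
    "\<alpha>' \<cdot> \<alpha> A = Id C (ob G (ob F A))"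
    using \<alpha>(1)[of A] unfolding is_iso_def by (elim conjE bexE) (rule that)
  obtain \<beta>' where \<beta>': "\<beta> B \<in> Hom C (ob F (ob G B)) B" "\<beta>' \<in> Hom C B (ob F (ob G B))" "\<beta> B \<cdot> \<beta>' = Id C B"
    "\<beta>' \<cdot> \<beta> B = Id C (ob F (ob G B))"
    using \<beta>(1)[of B] unfolding is_iso_def by (elim conjE bexE) (rule that)
  show ?thesis
  proof
    assume *: "orth A (ob G B)"
    show "orth (ob F A) B"
    proof (rule orthI)
      fix u assume u: "u \<in> Hom C (ob F A) B"
      obtain \<gamma>' where \<gamma>': "\<beta> (ob F A) \<in> Hom C (ob F (ob G (ob F A))) (ob F A)"
        "\<gamma>' \<in> Hom C (ob F A) (ob F (ob G (ob F A)))" "\<beta> (ob F A) \<cdot> \<gamma>' = Id C (ob F A)"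
        using \<beta>(1)[of "ob F A"] unfolding is_iso_def by (elim conjE bexE) (rule that)
      have "orth (ob G (ob F A)) (ob G B)"
        using orth_retract_left[OF \<alpha>'(1,2,4) *] .
      then have "mor G u = 0"
        using G[OF u] by simp
      then have "u \<cdot> \<beta> (ob F A) = 0"
        using \<beta>(2)[OF u] F0 comp_zero_right[OF \<beta>'(1)] by simp
      then have "u \<cdot> (\<beta> (ob F A) \<cdot> \<gamma>') = 0"
        using comp_assoc[OF \<gamma>'(2,1) u] comp_zero_left[OF \<gamma>'(2)] by simp
      then show "u = 0"
        using \<gamma>'(3) comp_Id_right[OF u] by simp
    qed
  next
    assume *: "orth (ob F A) B"
    show "orth A (ob G B)"
    proof (rule orthI)
      fix u assume u: "u \<in> Hom C A (ob G B)"
      have m: "\<alpha> (ob G B) \<in> Hom C (ob G (ob F (ob G B))) (ob G B)"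
        using \<alpha>(1)[of "ob G B"] unfolding is_iso_def by simp
      have "orth (ob F A) (ob F (ob G B))"
        using orth_retract_right[OF \<beta>'(1,2,4) *] .
      then have "mor F u = 0"
        using F[OF u] by simp
      then have "u \<cdot> \<alpha> A = 0"
        using \<alpha>(2)[OF u] G0 comp_zero_right[OF m] by simp
      then have "u \<cdot> (\<alpha> A \<cdot> \<alpha>') = 0"
        using comp_assoc[OF \<alpha>'(2,1) u] comp_zero_left[OF \<alpha>'(2)] by simp
      then show "u = 0"
        using \<alpha>'(3) comp_Id_right[OF u] by simp
    qed
  qed
qed

text \<open>
  \<open>corepresents_dual B P t\<close>: the functional \<open>t\<close> exhibits \<open>P\<close> as a corepresenting object of the functor
  \<open>X \<mapsto> D Hom(X, B)\<close>; by Serre duality \<open>P = \<nu>\<inverse> B\<close> is such an object.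
\<close>

definition corepresents_dual :: "'o \<Rightarrow> 'o \<Rightarrow> ('m \<Rightarrow> 'k) \<Rightarrow> bool" where
  "corepresents_dual B P t \<longleftrightarrow>
     (\<forall>g\<in>Hom C P B. \<forall>g'\<in>Hom C P B. t (g + g') = t g + t g') \<and>
     (\<forall>g\<in>Hom C P B. \<forall>a. t (scl C a g) = a * t g) \<and>
     (\<forall>X. \<forall>f\<in>Hom C P X. \<forall>f'\<in>Hom C P X. (\<forall>g\<in>Hom C X B. t (g \<cdot> f) = t (g \<cdot> f')) \<longrightarrow> f = f') \<and>
     (\<forall>X. \<forall>\<phi>\<in>dual C (Hom C X B). \<exists>f\<in>Hom C P X. \<forall>g\<in>Hom C X B. t (g \<cdot> f) = \<phi> g)"

lemma corepresents_dual_represent: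
  assumes "corepresents_dual B P t"
    and "\<And>g g'. g \<in> Hom C X B \<Longrightarrow> g' \<in> Hom C X B \<Longrightarrow> \<phi> (g + g') = \<phi> g + \<phi> g'"
    and "\<And>g a. g \<in> Hom C X B \<Longrightarrow> \<phi> (scl C a g) = a * \<phi> g"
  obtains f where "f \<in> Hom C P X" "\<forall>g\<in>Hom C X B. t (g \<cdot> f) = \<phi> g"
proof -
  define \<psi> where "\<psi> = (\<lambda>g. if g \<in> Hom C X B then \<phi> g else 0)"
  have "\<psi> \<in> dual C (Hom C X B)"
    unfolding \<psi>_def dual_def using assms(2,3) by (auto simp: add_in_Hom scl_in_Hom)
  then obtain f where "f \<in> Hom C P X" "\<forall>g\<in>Hom C X B. t (g \<cdot> f) = \<psi> g"
    using assms(1) unfolding corepresents_dual_def by blast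
  then show ?thesis
    using that by (simp add: \<psi>_def)
qed

lemma corepresents_dual_cancel:
  assumes "corepresents_dual B P t" "f \<in> Hom C P X" "f' \<in> Hom C P X"
    and "\<And>g. g \<in> Hom C X B \<Longrightarrow> t (g \<cdot> f) = t (g \<cdot> f')"
  shows "f = f'"
  using assms unfolding corepresents_dual_def by blast

text \<open>Yoneda: \<open>f\<close> represents \<open>s\<close> with respect to \<open>t\<close>,
  \<open>h\<close> represents \<open>t\<close> with respect to \<open>s\<close>, and cancellation
  makes them mutually inverse.\<close>

lemma corepresents_dual_unique:
  assumes P: "corepresents_dual B P t" and Q: "corepresents_dual B Q s"
  obtains f h where "f \<in> Hom C P Q" "h \<in> Hom C Q P" "h \<cdot> f = Id C P" "f \<cdot> h = Id C Q"
proof -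
  obtain f where f: "f \<in> Hom C P Q" "\<And>g. g \<in> Hom C Q B \<Longrightarrow> t (g \<cdot> f) = s g"
    using corepresents_dual_represent[OF P, of Q s] Q unfolding corepresents_dual_def by metis
  obtain h where h: "h \<in> Hom C Q P" "\<And>g. g \<in> Hom C P B \<Longrightarrow> s (g \<cdot> h) = t g"
    using corepresents_dual_represent[OF Q, of P t] P unfolding corepresents_dual_def by metis
  have "h \<cdot> f = Id C P"
  proof (rule corepresents_dual_cancel[OF P comp_in_Hom[OF f(1) h(1)] Id_in_Hom])
    fix g assume g: "g \<in> Hom C P B"
    then show "t (g \<cdot> (h \<cdot> f)) = t (g \<cdot> Id C P)"
      using comp_assoc[OF f(1) h(1) g] f(2)[OF comp_in_Hom[OF h(1) g]] h(2)[OF g] comp_Id_right[OF g]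
      by simp
  qed
  moreover have "f \<cdot> h = Id C Q"
  proof (rule corepresents_dual_cancel[OF Q comp_in_Hom[OF h(1) f(1)] Id_in_Hom])
    fix g assume g: "g \<in> Hom C Q B"
    then show "s (g \<cdot> (f \<cdot> h)) = s (g \<cdot> Id C Q)"
      using comp_assoc[OF h(1) f(1) g] h(2)[OF comp_in_Hom[OF f(1) g]] f(2)[OF g] comp_Id_right[OF g]
      by simp
  qed
  ultimately show ?thesis
    using that f(1) h(1) by blast
qed

text \<open>The functional is the Serre trace on \<open>P\<close>, the value of \<eta> at the
  identity, transported along B \<cong> \<nu> P. By naturality it determines \<eta> at every map out
  of \<open>P\<close>, so bijectivity of \<eta> gives the last two clauses.\<close>

lemma Serre_corepresents_dual:
  assumes Serre: "Serre_functor C \<nu>" and qi: "quasi_inverse C \<nu> \<nu>'"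
  obtains t where "corepresents_dual B (ob \<nu>' B) t"
proof -
  define P where "P = ob \<nu>' B"
  obtain \<eta> where bij: "\<And>X Y. bij_betw (\<eta> X Y) (Hom C X Y) (dual C (Hom C Y (ob \<nu> X)))"
    and nat: "\<And>X X' Y Y' a b f g. a \<in> Hom C X' X \<Longrightarrow> b \<in> Hom C Y Y' \<Longrightarrow> f \<in> Hom C X Y \<Longrightarrow>
      g \<in> Hom C Y' (ob \<nu> X') \<Longrightarrow> \<eta> X' Y' (b \<cdot> f \<cdot> a) g = \<eta> X Y f (mor \<nu> a \<cdot> g \<cdot> b)"
    using Serre unfolding Serre_functor_def by (elim conjE exE) (rule that, blast+)
  have \<nu>Id: "mor \<nu> (Id C X) = Id C (ob \<nu> X)" for X
    using qi unfolding quasi_inverse_def linear_functor_def by simp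
  obtain \<beta> where "is_iso C (ob \<nu> P) B \<beta>"
    using qi unfolding quasi_inverse_def comp_iso_identity_def P_def by blast
  then obtain \<gamma> where \<beta>: "\<beta> \<in> Hom C (ob \<nu> P) B" and \<gamma>: "\<gamma> \<in> Hom C B (ob \<nu> P)"
    and inv: "\<gamma> \<cdot> \<beta> = Id C (ob \<nu> P)" "\<beta> \<cdot> \<gamma> = Id C B"
    unfolding is_iso_def by blast
  define t where "t = (\<lambda>g. \<eta> P P (Id C P) (\<gamma> \<cdot> g))"
  have \<eta>_dual: "\<eta> P X f \<in> dual C (Hom C X (ob \<nu> P))" if "f \<in> Hom C P X" for X f
    using bij_betwE[OF bij] that by blast
  have t: "t (g \<cdot> f) = \<eta> P X f (\<gamma> \<cdot> g)" if f: "f \<in> Hom C P X" and g: "g \<in> Hom C X B" for f g X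
    using nat[OF Id_in_Hom f Id_in_Hom comp_in_Hom[OF g \<gamma>]] \<nu>Id
      comp_Id_right[OF f] comp_Id_left[OF comp_in_Hom[OF g \<gamma>]] comp_assoc[OF f g \<gamma>]
    by (simp add: t_def)
  have "corepresents_dual B P t"
    unfolding corepresents_dual_def
  proof (intro conjI ballI allI impI)
    fix g g' assume g: "g \<in> Hom C P B" "g' \<in> Hom C P B"
    show "t (g + g') = t g + t g'"
      using \<eta>_dual[OF Id_in_Hom] comp_in_Hom[OF g(1) \<gamma>] comp_in_Hom[OF g(2) \<gamma>]
      unfolding t_def dual_def by (simp add: comp_add_right[OF g \<gamma>])
  next
    fix g a assume g: "g \<in> Hom C P B"
    show "t (scl C a g) = a * t g"
      using \<eta>_dual[OF Id_in_Hom] comp_in_Hom[OF g \<gamma>]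
      unfolding t_def dual_def by (simp add: comp_scl_right[OF g \<gamma>])
  next
    fix X f f' assume f: "f \<in> Hom C P X" "f' \<in> Hom C P X"
      and *: "\<forall>g\<in>Hom C X B. t (g \<cdot> f) = t (g \<cdot> f')"
    have "\<eta> P X f x = \<eta> P X f' x" for x
    proof (cases "x \<in> Hom C X (ob \<nu> P)")
      case True
      then have "\<gamma> \<cdot> (\<beta> \<cdot> x) = x"
        using comp_assoc[OF True \<beta> \<gamma>] inv comp_Id_left[OF True] by simp
      moreover have "\<beta> \<cdot> x \<in> Hom C X B"
        using comp_in_Hom[OF True \<beta>] .
      ultimately show ?thesis
        using * t f by metis
    next
      case False
      then show ?thesis
        using \<eta>_dual f unfolding dual_def by simp
    qed
    then show "f = f'"
      using f inj_onD[OF bij_betw_imp_inj_on[OF bij]] by blast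
  next
    fix X \<phi> assume \<phi>: "\<phi> \<in> dual C (Hom C X B)"
    \<comment> \<open>The functional pulled back along \<beta>, extended by zero as
      \<open>dual\<close> requires.\<close>
    define \<psi> where "\<psi> = (\<lambda>x. if x \<in> Hom C X (ob \<nu> P) then \<phi> (\<beta> \<cdot> x) else 0)"
    have "\<psi> \<in> dual C (Hom C X (ob \<nu> P))"
      using \<phi> unfolding dual_def \<psi>_def
      by (auto simp: add_in_Hom scl_in_Hom comp_add_right[OF _ _ \<beta>] comp_scl_right[OF _ \<beta>] comp_in_Hom[OF _ \<beta>])
    then obtain f where f: "f \<in> Hom C P X" "\<eta> P X f = \<psi>"
      using bij_betw_imp_surj_on[OF bij[of P X]] by (metis imageE)
    have "t (g \<cdot> f) = \<phi> g" if g: "g \<in> Hom C X B" for g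
      using t[OF f(1) g] f(2) comp_in_Hom[OF g \<gamma>] comp_assoc[OF g \<gamma> \<beta>] inv comp_Id_left[OF g]
      by (simp add: \<psi>_def)
    then show "\<exists>f\<in>Hom C P X. \<forall>g\<in>Hom C X B. t (g \<cdot> f) = \<phi> g"
      using f(1) by blast
  qed
  then show ?thesis
    using that P_def by blast
qed

text \<open>The pairing \<open>t (g \<cdot> f)\<close> separates maps out of \<open>P\<close> and
  realizes every functional on Hom(X, B); a space whose dual is trivial is zero.\<close>

lemma corepresents_dual_orth:
  assumes P: "corepresents_dual B P t"
  shows "orth P X \<longleftrightarrow> orth X B"
proof
  assume "orth X B"
  moreover have "t (0 \<cdot> f) = t 0" if "f \<in> Hom C P X" for f
    using comp_zero_left[OF that] by simp
  ultimately show "orth P X"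
    using corepresents_dual_cancel[OF P, of _ X 0] comp_zero_left[of _ P X] comp_zero_left[OF zero_in_Hom]
    by (intro orthI) simp
next
  assume *: "orth P X"
  have t0: "t 0 = 0"
    using P zero_in_Hom unfolding corepresents_dual_def by (metis add_cancel_right_right add_0)
  show "orth X B"
  proof (rule dual_trivial_imp_trivial[OF Hom_subspace], rule ext)
    fix \<phi> g assume \<phi>: "\<phi> \<in> dual C (Hom C X B)"
    show "\<phi> g = 0"
    proof (cases "g \<in> Hom C X B")
      case True
      obtain f where "f \<in> Hom C P X" "\<forall>g\<in>Hom C X B. t (g \<cdot> f) = \<phi> g"
        using P \<phi> unfolding corepresents_dual_def by blast
      then show ?thesis
        using * True t0 comp_zero_right[OF True] by auto
    qed (use \<phi> in \<open>auto simp: dual_def\<close>)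
  qed
qed

end

context triangulated_category
begin

text \<open>Serves to compare \<nu>\<inverse>(B[1]) with (\<nu>\<inverse> B)[1]: a Serre functor is
  given only as a linear autoequivalence, without a compatibility with the shift.\<close>

lemma corepresents_dual_sh1:
  assumes P: "corepresents_dual B P t"
  obtains s where "corepresents_dual (sh1 T B) (sh1 T P) s"
proof -
  \<comment> \<open>Undoes the shift on maps P \<rightarrow> B, so that \<open>t\<close> can be
    evaluated on maps P[1] \<rightarrow> B[1].\<close>
  define r where "r = inv_into (Hom T P B) (shm T)"
  have r: "r (shm T g) = g" if "g \<in> Hom T P B" for g
    unfolding r_def using inv_into_f_f[OF bij_betw_imp_inj_on[OF shift_bij_mor] that] .
  have "corepresents_dual (sh1 T B) (sh1 T P) (\<lambda>g. t (r g))"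
    unfolding corepresents_dual_def
  proof (intro conjI ballI allI impI)
    fix g g' assume "g \<in> Hom T (sh1 T P) (sh1 T B)" "g' \<in> Hom T (sh1 T P) (sh1 T B)"
    then obtain h h' where h: "h \<in> Hom T P B" "h' \<in> Hom T P B" "g = shm T h" "g' = shm T h'"
      by (metis shmE)
    then have "r (g + g') = h + h'" "r g = h" "r g' = h'"
      using r add_in_Hom by (simp_all flip: shm_add)
    then show "t (r (g + g')) = t (r g) + t (r g')"
      using P h unfolding corepresents_dual_def by simp
  next
    fix g a assume "g \<in> Hom T (sh1 T P) (sh1 T B)"
    then obtain h where h: "h \<in> Hom T P B" "g = shm T h"
      by (metis shmE)
    then have "r (scl T a g) = scl T a h" "r g = h"
      using r scl_in_Hom by (simp_all flip: shm_scl)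
    then show "t (r (scl T a g)) = a * t (r g)"
      using P h unfolding corepresents_dual_def by simp
  next
    fix X f f'
    assume f: "f \<in> Hom T (sh1 T P) X" "f' \<in> Hom T (sh1 T P) X"
      and *: "\<forall>g\<in>Hom T X (sh1 T B). t (r (g \<cdot> f)) = t (r (g \<cdot> f'))"
    define Y where "Y = inv (sh1 T) X"
    have X: "X = sh1 T Y"
      by (simp add: Y_def sh1_inv)
    obtain h h' where h: "h \<in> Hom T P Y" "h' \<in> Hom T P Y" "f = shm T h" "f' = shm T h'"
      using f unfolding X by (metis shmE)
    have "h = h'"
    proof (rule corepresents_dual_cancel[OF P h(1,2)])
      fix g assume g: "g \<in> Hom T Y B"
      have "t (r (shm T g \<cdot> f)) = t (r (shm T g \<cdot> f'))"
        using * shm_in_Hom[OF g] unfolding X by blast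
      then show "t (g \<cdot> h) = t (g \<cdot> h')"
        using r comp_in_Hom[OF _ g] h shm_comp[OF _ g] by metis
    qed
    then show "f = f'"
      using h by simp
  next
    fix X \<phi>
    assume \<phi>: "\<phi> \<in> dual T (Hom T X (sh1 T B))"
    define Y where "Y = inv (sh1 T) X"
    have X: "X = sh1 T Y"
      by (simp add: Y_def sh1_inv)
    obtain h where h: "h \<in> Hom T P Y" "\<forall>g\<in>Hom T Y B. t (g \<cdot> h) = \<phi> (shm T g)"
    proof (rule corepresents_dual_represent[OF P, of Y "\<lambda>g. \<phi> (shm T g)"])
      fix g g' assume "g \<in> Hom T Y B" "g' \<in> Hom T Y B"
      then show "\<phi> (shm T (g + g')) = \<phi> (shm T g) + \<phi> (shm T g')"
        using \<phi> shm_in_Hom unfolding dual_def X by (simp add: shm_add)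
    next
      fix g a assume "g \<in> Hom T Y B"
      then show "\<phi> (shm T (scl T a g)) = a * \<phi> (shm T g)"
        using \<phi> shm_in_Hom unfolding dual_def X by (simp add: shm_scl)
    qed
    have "t (r (g \<cdot> shm T h)) = \<phi> g" if "g \<in> Hom T X (sh1 T B)" for g
    proof -
      obtain g' where g': "g' \<in> Hom T Y B" "g = shm T g'"
        using \<open>g \<in> Hom T X (sh1 T B)\<close> unfolding X by (metis shmE)
      then show ?thesis
        using h r[OF comp_in_Hom[OF h(1) g'(1)]] by (simp add: shm_comp)
    qed
    then show "\<exists>f\<in>Hom T (sh1 T P) X. \<forall>g\<in>Hom T X (sh1 T B). t (r (g \<cdot> f)) = \<phi> g"
      using shm_in_Hom[OF h(1)] unfolding X by blast
  qed
  then show ?thesis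
    by (rule that)
qed

end

locale serre_category = triangulated_category T
  for T :: "('k::field, 'o, 'm::ab_group_add, 'z) tri_cat_scheme" (structure) +
  fixes \<nu> \<nu>' :: "('o, 'm) endofunctor"
  assumes Serre: "Serre_functor T \<nu>" and quasi_inv: "quasi_inverse T \<nu> \<nu>'"
begin

lemma orth_nu_inv_left: "orth (ob \<nu>' B) X \<longleftrightarrow> orth X B"
  using Serre_corepresents_dual[OF Serre quasi_inv] corepresents_dual_orth by metis

lemma orth_nu_inv_sh1: "orth A (ob \<nu>' (sh1 T B)) \<longleftrightarrow> orth A (sh1 T (ob \<nu>' B))"
proof -
  obtain t s where "corepresents_dual (sh1 T B) (ob \<nu>' (sh1 T B)) t"
    "corepresents_dual (sh1 T B) (sh1 T (ob \<nu>' B)) s"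
    using Serre_corepresents_dual[OF Serre quasi_inv] corepresents_dual_sh1 by metis
  then obtain f h where "f \<in> Hom T (ob \<nu>' (sh1 T B)) (sh1 T (ob \<nu>' B))"
    "h \<in> Hom T (sh1 T (ob \<nu>' B)) (ob \<nu>' (sh1 T B))"
    "h \<cdot> f = Id T (ob \<nu>' (sh1 T B))" "f \<cdot> h = Id T (sh1 T (ob \<nu>' B))"
    by (rule corepresents_dual_unique)
  then show ?thesis
    using orth_retract_right by metis
qed

text \<open>With \<open>B\<close> alone on the right, biproducts, additive closures and triangles
  can be used in the second argument without applying \<nu>\<inverse> to them.\<close>

lemma orth_nu_d_inv: "orth A (sh T j (nu_d_inv T \<nu>' d B)) \<longleftrightarrow> orth (ob \<nu> (sh T (- (j + d)) A)) B"
  unfolding nu_d_inv_def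
  by (simp add: orth_sh_move[of A] quasi_inverse_orth[OF quasi_inv] flip: sh_add)

text \<open>Substitutes for a triangle of the objects \<open>\<nu>\<^sub>d\<inverse> X\<close>,
  \<open>\<nu>\<^sub>d\<inverse> Y\<close>, \<open>\<nu>\<^sub>d\<inverse> Z\<close>. The rotated
  triangle contains X[1], which is where \<open>orth_nu_inv_sh1\<close> enters.\<close>

lemma nu_d_inv_exact:
  assumes D: "dist T X Y Z f g h"
    and "orth A (sh T j (nu_d_inv T \<nu>' d Y))" "orth A (sh T (j + 1) (nu_d_inv T \<nu>' d X))"
  shows "orth A (sh T j (nu_d_inv T \<nu>' d Z))"
proof -
  have "orth (sh T (- (j + d)) A) (sh1 T (ob \<nu>' X))"
    using assms(3) orth_sh_move[of A "j + d" "sh1 T (ob \<nu>' X)"]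
    by (simp add: nu_d_inv_def sh_sh1 algebra_simps flip: sh_add)
  then have "orth (ob \<nu> (sh T (- (j + d)) A)) (sh1 T X)"
    by (simp add: quasi_inverse_orth[OF quasi_inv] flip: orth_nu_inv_sh1)
  then show ?thesis
    using dist_orth_right_mid[OF dist_rot[OF D]] assms(2) by (simp add: orth_nu_d_inv)
qed

lemma nu_d_inv_pair:
  assumes "direct_sum T [Y, X] N"
  shows "orth A (sh T j (nu_d_inv T \<nu>' d N)) \<longleftrightarrow>
    orth A (sh T j (nu_d_inv T \<nu>' d Y)) \<and> orth A (sh T j (nu_d_inv T \<nu>' d X))"
  using orth_pair_right_iff[OF assms] by (simp add: orth_nu_d_inv)

text \<open>Serre duality with the shift by d moved across Hom; it converts condition (2) into a
  condition on maps into the top.\<close>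

lemma orth_nu_d_inv_left: "orth (nu_d_inv T \<nu>' d B) A \<longleftrightarrow> orth A (sh T d B)"
  using orth_sh_move[of "ob \<nu>' B" "- d" A] orth_nu_inv_left[of B "sh T (- d) A"] orth_sh_move[of A d B]
  by (simp add: nu_d_inv_def)

end

section \<open>Mutation\<close>

context triangulated_category
begin

lemma orth_sh1_left: "orth (sh1 T X) (sh T (j + 1) V) \<longleftrightarrow> orth X (sh T j V)"
  by (simp add: sh_succ orth_sh1)

text \<open>In the exact sequence Hom(X0, V) \<rightarrow> Hom(X, V) \<rightarrow> Hom(Y, V[1])
  \<rightarrow> Hom(X0, V[1]) the last term is zero, so the third vanishes exactly when the first
  map is onto.\<close>

lemma orth_cone_iff_factors:
  assumes D: "dist T X X0 Y f g h" and X0: "orth X0 (sh1 T V)"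
  shows "orth Y (sh1 T V) \<longleftrightarrow> (\<forall>u\<in>Hom T X V. \<exists>v\<in>Hom T X0 V. u = v \<cdot> f)"
proof (intro iffI ballI)
  have m: "f \<in> Hom T X X0" "g \<in> Hom T X0 Y" "h \<in> Hom T Y (sh1 T X)"
    using dist_in_Hom[OF D] by auto
  {
    fix u assume Y: "orth Y (sh1 T V)" and u: "u \<in> Hom T X V"
    have "shm T u \<cdot> h = 0"
      using comp_in_Hom[OF m(3) shm_in_Hom[OF u]] Y by simp
    then obtain v' where v': "v' \<in> Hom T (sh1 T X0) (sh1 T V)" "shm T u = v' \<cdot> (- shm T f)"
      using dist_extend[OF dist_rot[OF dist_rot[OF D]] shm_in_Hom[OF u]] by blast
    obtain v where v: "v \<in> Hom T X0 V" "v' = shm T v"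
      using v'(1) by (rule shmE)
    have "shm T u = - (shm T v \<cdot> shm T f)"
      using v' v(2) comp_uminus_right[OF shm_in_Hom[OF m(1)] shm_in_Hom[OF v(1)]] by simp
    also have "\<dots> = shm T (- (v \<cdot> f))"
      using shm_uminus[OF comp_in_Hom[OF m(1) v(1)]] shm_comp[OF m(1) v(1)] by simp
    finally have "u = - (v \<cdot> f)"
      using shm_inject[OF u uminus_in_Hom[OF comp_in_Hom[OF m(1) v(1)]]] by simp
    then have "u = (- v) \<cdot> f"
      using comp_uminus_left[OF m(1) v(1)] by simp
    then show "\<exists>v\<in>Hom T X0 V. u = v \<cdot> f"
      using uminus_in_Hom[OF v(1)] by blast
  next
    assume *: "\<forall>u\<in>Hom T X V. \<exists>v\<in>Hom T X0 V. u = v \<cdot> f"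
    show "orth Y (sh1 T V)"
    proof (rule orthI)
      fix y assume y: "y \<in> Hom T Y (sh1 T V)"
      have "y \<cdot> g = 0"
        using comp_in_Hom[OF m(2) y] X0 by simp
      then obtain u' where u': "u' \<in> Hom T (sh1 T X) (sh1 T V)" "y = u' \<cdot> h"
        using dist_extend2[OF D y] by blast
      obtain u where u: "u \<in> Hom T X V" "u' = shm T u"
        using u'(1) by (rule shmE)
      obtain v where v: "v \<in> Hom T X0 V" "u = v \<cdot> f"
        using * u(1) by blast
      have "y = shm T v \<cdot> (shm T f \<cdot> h)"
        using u' u(2) v shm_comp[OF m(1) v(1)]
          comp_assoc[OF m(3) shm_in_Hom[OF m(1)] shm_in_Hom[OF v(1)]] by simp
      then show "y = 0"
        using dist_comp_zero3[OF D] comp_zero_right[OF shm_in_Hom[OF v(1)]] by simp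
    qed
  }
qed

text \<open>Applied with \<open>G\<close> the identity and with \<open>G = \<nu>\<^sub>d\<inverse>\<close>.\<close>

lemma mutation_orth_iff:
  fixes G :: "'o \<Rightarrow> 'o"
  assumes D: "dist T X X0 Y f g h" and X0: "X0 \<in> add_closure T X'" and N: "direct_sum T [Y, X'] N"
    and exact: "\<And>A j. orth A (sh T j (G X0)) \<Longrightarrow> orth A (sh T (j + 1) (G X)) \<Longrightarrow> orth A (sh T j (G Y))"
    and add: "\<And>A j. orth A (sh T j (G X')) \<Longrightarrow> orth A (sh T j (G X0))"
    and pair: "\<And>A j. orth A (sh T j (G N)) \<longleftrightarrow> orth A (sh T j (G Y)) \<and> orth A (sh T j (G X'))"
    and base: "\<And>A B j. A \<in> {X, X'} \<Longrightarrow> B \<in> {X, X'} \<Longrightarrow> 0 < j \<Longrightarrow> orth A (sh T j (G B))"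
  shows "(\<forall>j>0. orth N (sh T j (G N))) \<longleftrightarrow> (\<forall>u\<in>Hom T X (G X'). \<exists>v\<in>Hom T X0 (G X'). u = v \<cdot> f)"
proof -
  have baseX0: "orth X0 (sh T j (G B))" if "B \<in> {X, X'}" "0 < j" for B j
    using orth_add_closure_left[OF X0] base that by blast
  have X'Y: "orth X' (sh T j (G Y))" if "0 < j" for j
    using exact[OF add] base that by simp
  \<comment> \<open>\<open>Y\<close> lies between \<open>X0\<close> and X[1], and moving the shift
    off X[1] costs one degree. Hence degrees at least 2 are automatic and only degree 1 carries
    information.\<close>
  have Y2: "orth Y (sh T (j + 1) (G B))" if "B \<in> {X, X'}" "0 < j" for B j
    using dist_orth_left_mid[OF dist_rot[OF D]] baseX0[OF that(1), of "j + 1"]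
      base[OF _ that, of X] that(2) by (simp add: orth_sh1_left)
  have YX': "orth Y (sh T j (G X'))" if "orth Y (sh1 T (G X'))" "0 < j" for j
  proof (cases "j = 1")
    case False
    then show ?thesis
      using Y2[of X' "j - 1"] that(2) by simp
  qed (use that in \<open>simp add: sh_1\<close>)
  have "orth N (sh T j (G N))" if "orth Y (sh1 T (G X'))" "0 < j" for j
  proof -
    \<comment> \<open>Exactness in the second argument asks for \<open>X0\<close> in degree j,
      covered by the assumption on \<open>X'\<close>, and for \<open>X\<close> in degree j + 1,
      which is at least 2.\<close>
    have "orth Y (sh T j (G Y))"
      using exact[OF add] YX'[OF that] Y2[of X j] that(2) by simp
    then show ?thesis
      using orth_pair_left_iff[OF N] pair YX'[OF that] X'Y[OF that(2)] base[of X' X' j] that(2) by simp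
  qed
  moreover have "orth Y (sh1 T (G X'))" if "\<forall>j>0. orth N (sh T j (G N))"
  proof -
    have "orth N (sh T 1 (G N))"
      using that by simp
    then show ?thesis
      using orth_pair_left_iff[OF N] pair[of Y 1] by (simp add: sh_1)
  qed
  ultimately have "(\<forall>j>0. orth N (sh T j (G N))) \<longleftrightarrow> orth Y (sh1 T (G X'))"
    by blast
  also have "\<dots> \<longleftrightarrow> (\<forall>u\<in>Hom T X (G X'). \<exists>v\<in>Hom T X0 (G X'). u = v \<cdot> f)"
    using orth_cone_iff_factors[OF D] baseX0[of X' 1] by (simp add: sh_1)
  finally show ?thesis .
qed

text \<open>For the identity as \<open>G\<close>, the factorization criterion is the approximation
  property itself. Generation holds because \<open>X\<close> is the fibre of X0 \<rightarrow> Y, so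
  \<open>M\<close> can be rebuilt from \<open>N\<close>.\<close>

lemma silting_left_mutation:
  assumes M: "silting T M" "direct_sum T [X, X'] M"
    and f: "left_approximation T (add_closure T X') X X0 f" and D: "dist T X X0 Y f g h"
    and N: "direct_sum T [Y, X'] N"
  shows "silting T N"
proof -
  have X0: "X0 \<in> add_closure T X'"
    and app: "\<And>W u. W \<in> add_closure T X' \<Longrightarrow> u \<in> Hom T X W \<Longrightarrow> \<exists>v\<in>Hom T X0 W. u = v \<cdot> f"
    using f unfolding left_approximation_def by blast+
  have N_shift: "orth A (sh T j N) \<longleftrightarrow> orth A (sh T j Y) \<and> orth A (sh T j X')" for A j
    using orth_pair_right_iff[OF N, of "sh T (- j) A"] by (simp add: orth_sh_move)
  have M_shift: "orth A (sh T j M) \<longleftrightarrow> orth A (sh T j X) \<and> orth A (sh T j X')" for A j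
    using orth_pair_right_iff[OF M(2), of "sh T (- j) A"] by (simp add: orth_sh_move)
  have add: "orth A (sh T j X0)" if "orth A (sh T j X')" for A j
    using orth_add_closure_right[OF X0, of "sh T (- j) A"] that by (simp add: orth_sh_move)
  have base: "orth A (sh T j B)" if "A \<in> {X, X'}" "B \<in> {X, X'}" "0 < j" for A B j
  proof -
    have "orth M (sh T j M)"
      using M(1) \<open>0 < j\<close> unfolding silting_def by blast
    then have "orth M (sh T j B)"
      using M_shift[of M j] that(2) by auto
    then show ?thesis
      using orth_pair_left_iff[OF M(2), of "sh T j B"] that(1) by auto
  qed
  have "\<forall>j>0. orth N (sh T j N)"
    using mutation_orth_iff[OF D X0 N, of "\<lambda>A. A", OF dist_sh_orth_right(2)[OF D] add N_shift base]
      app[OF self_in_add_closure] by blast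
  moreover have "thick T N = UNIV"
  proof -
    have "M \<in> A" if A: "thick_subcategory T A" and "N \<in> A" for A
    proof -
      have summand: "\<And>U V W. direct_sum T [U, V] W \<Longrightarrow> W \<in> A \<Longrightarrow> U \<in> A"
        using A unfolding thick_subcategory_def by blast
      obtain i j p q where "i \<in> Hom T Y N" "j \<in> Hom T X' N" "p \<in> Hom T N Y" "q \<in> Hom T N X'"
        "q \<cdot> j = Id T X'"
        by (rule direct_sum_pairE[OF N])
      then have "X' \<in> A"
        using thick_retract[OF A \<open>N \<in> A\<close>] by blast
      moreover from this have "X0 \<in> A"
        using thick_add_closure[OF A _ X0] by blast
      then have "X \<in> A"
        using thick_fibre[OF A D] summand[OF N \<open>N \<in> A\<close>] by blast
      ultimately show ?thesis
        using thick_direct_sum_pair[OF A M(2)] by blast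
    qed
    then have "thick T M \<subseteq> thick T N"
      unfolding thick_def by blast
    then show ?thesis
      using M(1) unfolding silting_def by blast
  qed
  ultimately show ?thesis
    unfolding silting_def by blast
qed

end

section \<open>The silting t-structure\<close>

locale silting_t_structure = triangulated_category T
  for T :: "('k::field, 'o, 'm::ab_group_add, 'z) tri_cat_scheme" (structure) +
  fixes M :: 'o
  assumes silting: "silting T M"
    and t_structure: "admits_right_adjacent_t_structure T M"
begin

section \<open>Aisle, coaisle and truncation\<close>

abbreviation le0 :: "'o \<Rightarrow> bool" where
  "le0 X \<equiv> \<forall>i>0. orth M (sh T i X)"

abbreviation lt0 :: "'o \<Rightarrow> bool" where
  "lt0 X \<equiv> \<forall>i\<ge>0. orth M (sh T i X)"

abbreviation ge0 :: "'o \<Rightarrow> bool" where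
  "ge0 X \<equiv> \<forall>i<0. orth M (sh T i X)"

abbreviation \<H> :: "'o set" where
  "\<H> \<equiv> heart T M"

lemma heart_iff: "X \<in> \<H> \<longleftrightarrow> le0 X \<and> ge0 X"
  unfolding heart_def silt_le0_def silt_ge0_def by blast

lemma le0_silting: "le0 M"
  using silting unfolding silting_def by blast

lemma lt0_sh1: "le0 X \<Longrightarrow> lt0 (sh1 T X)"
  by (simp add: sh_sh1)

lemma orth_generator_imp_zero: "(\<And>i. orth M (sh T i W)) \<Longrightarrow> zero_object T W"
  using orth_generator_zero silting unfolding silting_def by blast

lemma heart_nonzero:
  assumes "W \<in> \<H>" "\<not> zero_object T W"
  shows "\<not> orth M W"
proof
  assume "orth M W"
  then have "orth M (sh T i W)" for i
    using assms(1) unfolding heart_iff by (cases i "0::int" rule: linorder_cases) auto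
  then show False
    using orth_generator_imp_zero assms(2) by blast
qed

lemma orth_lt0_ge0:
  assumes "lt0 D" "ge0 W" shows "orth D W"
proof -
  \<comment> \<open>The axiom separates degrees \<le> 0 from degrees \<ge> 1, while here the gap is
    between -1 and 0; shifting by -1 aligns them.\<close>
  have "sh T (- 1) D \<in> silt_le0 T M"
    unfolding silt_le0_def using assms(1) by (simp flip: sh_add)
  moreover have "sh T (- 1) W \<in> trunc_class T (silt_ge0 T M) 1"
    unfolding trunc_class_def silt_ge0_def using assms(2) by (simp flip: sh_add)
  ultimately have "orth (sh T (- 1) D) (sh T (- 1) W)"
    using t_structure unfolding admits_right_adjacent_t_structure_def t_structure_def by blast
  then show ?thesis
    by (simp add: orth_sh)
qed

lemma le0_cone:
  assumes "dist T X Y Z f g h" "le0 X" "le0 Y" shows "le0 Z"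
  using dist_sh_orth_right(2)[OF assms(1)] assms(2,3) by simp

text \<open>Truncating C[-1] in degree 0 and shifting back truncates \<open>C\<close> in degree -1.
  The cone \<open>Q\<close> stays in the aisle, so it is a model of H^0 C.\<close>

lemma truncate:
  assumes "le0 C"
  obtains D Q d q h where "dist T D C Q d q h" "lt0 D" "Q \<in> \<H>"
proof -
  have "\<exists>A B. truncation T (silt_le0 T M) (silt_ge0 T M) 0 (sh T (- 1) C) A B"
    using t_structure unfolding admits_right_adjacent_t_structure_def t_structure_def by blast
  then obtain A B f g h where A: "le0 A" and B: "ge0 (sh1 T B)" and D: "dist T A (sh T (- 1) C) B f g h"
    unfolding truncation_def trunc_class_def silt_le0_def silt_ge0_def by (auto simp: sh_1)
  have C: "sh1 T (sh T (- 1) C) = C"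
    using sh_succ[of "- 1" C] by simp
  have D': "dist T (sh1 T A) C (sh1 T B) (- shm T f) (- shm T g) (- shm T h)"
    using dist_sh1[OF D] C by simp
  have "le0 (sh1 T B)"
    using le0_cone[OF D'] assms lt0_sh1[OF A] by simp
  then show ?thesis
    using that[OF D' lt0_sh1[OF A]] B heart_iff by blast
qed

text \<open>Together with \<open>heart_cancel\<close> this says that \<open>q\<close> is the
  reflection of \<open>C\<close> into the heart: neither \<open>D\<close> nor D[1] has maps to an
  object of the heart.\<close>

lemma heart_factor:
  assumes D: "dist T D C Q d q h" "lt0 D" and W: "W \<in> \<H>" and u: "u \<in> Hom T C W"
  obtains w where "w \<in> Hom T Q W" "u = w \<cdot> q"
proof -
  have "d \<in> Hom T D C"
    using dist_in_Hom[OF D(1)] by auto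
  then have "u \<cdot> d = 0"
    using comp_in_Hom[OF _ u, of d D] orth_lt0_ge0[OF D(2)] W heart_iff by simp
  then show ?thesis
    using dist_extend[OF D(1) u] that by blast
qed

lemma heart_cancel:
  assumes D: "dist T D C Q d q h" "lt0 D" and W: "W \<in> \<H>" and w: "w \<in> Hom T Q W" "w \<cdot> q = 0"
  shows "w = 0"
proof -
  have h: "h \<in> Hom T Q (sh1 T D)"
    using dist_in_Hom[OF D(1)] by auto
  obtain v where v: "v \<in> Hom T (sh1 T D) W" "w = v \<cdot> h"
    using dist_extend2[OF D(1) w] by blast
  have "orth (sh1 T D) W"
    using orth_lt0_ge0[OF lt0_sh1] D(2) W heart_iff by simp
  then show ?thesis
    using v comp_zero_left[OF h] by simp
qed

text \<open>The working substitute for epimorphisms of the heart. It also makes sense for maps that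
  start in the aisle outside the heart.\<close>

definition surj_from_M :: "'o \<Rightarrow> 'o \<Rightarrow> 'm \<Rightarrow> bool" where
  "surj_from_M X Y f \<longleftrightarrow> f \<in> Hom T X Y \<and> (\<forall>m\<in>Hom T M Y. \<exists>a\<in>Hom T M X. m = f \<cdot> a)"

lemma surj_from_M_comp:
  assumes f: "surj_from_M X Y f" and g: "surj_from_M Y Z g"
  shows "surj_from_M X Z (g \<cdot> f)"
  unfolding surj_from_M_def
proof (intro conjI ballI)
  have m: "f \<in> Hom T X Y" "g \<in> Hom T Y Z"
    using f g unfolding surj_from_M_def by auto
  then show "g \<cdot> f \<in> Hom T X Z"
    by (rule comp_in_Hom)
  fix z assume "z \<in> Hom T M Z"
  then obtain y where "y \<in> Hom T M Y" "z = g \<cdot> y"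
    using g unfolding surj_from_M_def by blast
  moreover from this(1) obtain x where "x \<in> Hom T M X" "y = f \<cdot> x"
    using f unfolding surj_from_M_def by blast
  ultimately show "\<exists>x\<in>Hom T M X. z = g \<cdot> f \<cdot> x"
    using comp_assoc[OF _ m] by metis
qed

lemma surj_from_M_cone:
  assumes D: "dist T X Y Z f g h" and "orth M (sh1 T X)" shows "surj_from_M Y Z g"
proof -
  have m: "g \<in> Hom T Y Z" "h \<in> Hom T Z (sh1 T X)"
    using dist_in_Hom[OF D] by auto
  show ?thesis
    unfolding surj_from_M_def
  proof (intro conjI ballI m)
    fix u assume u: "u \<in> Hom T M Z"
    then have "h \<cdot> u = 0"
      using comp_in_Hom[OF u m(2)] assms(2) by simp
    then show "\<exists>a\<in>Hom T M Y. u = g \<cdot> a"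
      using dist_lift2[OF D u] by blast
  qed
qed

lemma surj_from_M_truncate:
  assumes D: "dist T D C Q d q h" "lt0 D" shows "surj_from_M C Q q"
  using surj_from_M_cone[OF D(1)] D(2)[rule_format, of 1] by (simp add: sh_1)

text \<open>With \<open>surj_from_M_truncate\<close>, this identifies Hom(M, C) with Hom(M, Q), so a
  question about the cone can be decided in the heart.\<close>

lemma inj_from_M_truncate:
  assumes D: "dist T D C Q d q h" "lt0 D" and m: "m \<in> Hom T M C" "q \<cdot> m = 0"
  shows "m = 0"
proof -
  have d: "d \<in> Hom T D C"
    using dist_in_Hom[OF D(1)] by auto
  obtain v where "v \<in> Hom T M D" "m = d \<cdot> v"
    using dist_lift[OF D(1) m] by blast
  then show ?thesis
    using D(2)[rule_format, of 0] comp_zero_right[OF d] by simp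
qed

text \<open>Only degree 0 needs an argument: a map M \<rightarrow> C lifts to \<open>Y\<close>
  because Hom(M, X[1]) = 0, then to \<open>X\<close> by surjectivity, and two consecutive maps of a
  triangle compose to zero.\<close>

lemma surj_from_M_cone_lt0:
  assumes D: "dist T X Y C f c h" and "le0 X" "le0 Y" and f: "surj_from_M X Y f"
  shows "lt0 C"
proof -
  have m: "f \<in> Hom T X Y" "c \<in> Hom T Y C"
    using dist_in_Hom[OF D] by auto
  have "orth M C"
  proof (rule orthI)
    fix u assume u: "u \<in> Hom T M C"
    have "surj_from_M Y C c"
      using surj_from_M_cone[OF D] assms(2)[rule_format, of 1] by (simp add: sh_1)
    then obtain v where v: "v \<in> Hom T M Y" "u = c \<cdot> v"
      using u unfolding surj_from_M_def by blast
    obtain w where w: "w \<in> Hom T M X" "v = f \<cdot> w"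
      using f v(1) unfolding surj_from_M_def by blast
    show "u = 0"
      using v w comp_assoc[OF w(1) m] dist_comp_zero[OF D] comp_zero_left[OF w(1)] by simp
  qed
  then show ?thesis
    using le0_cone[OF D assms(2,3)] by (auto simp: le_less)
qed

text \<open>Produces kernels as fibres of the triangle. The fibre is a subobject because an object
  of the heart has no maps to B[-1].\<close>

lemma fibre_in_heart:
  assumes A: "A \<in> \<H>" and B: "B \<in> \<H>" and g: "surj_from_M A B g"
  obtains K k h where "dist T K A B k g h" "mono_in T \<H> K A k"
proof -
  have gm: "g \<in> Hom T A B"
    using g unfolding surj_from_M_def by blast
  obtain C c e where "dist T A B C g c e"
    using ex_cone[OF gm] by blast
  then have "dist T A B (sh1 T (inv (sh1 T) C)) g c e"
    by (simp add: sh1_inv)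
  then obtain K k where D: "dist T K A B k g c"
    by (rule dist_unrot)
  have m: "k \<in> Hom T K A" "c \<in> Hom T B (sh1 T K)"
    using dist_in_Hom[OF D] by auto
  \<comment> \<open>Away from degrees 0 and 1 both neighbours in the long exact sequence vanish. In
    degree 1 the neighbour Hom(M, B) does not, and surjectivity of \<open>g\<close> is what kills
    its image.\<close>
  have "orth M (sh T i K)" if "i \<noteq> 0" for i
  proof (cases "i = 1")
    case True
    have "orth M (sh1 T K)"
    proof (rule orthI)
      fix u assume u: "u \<in> Hom T M (sh1 T K)"
      have "(- shm T k) \<cdot> u \<in> Hom T M (sh1 T A)"
        by (rule comp_in_Hom[OF u uminus_in_Hom[OF shm_in_Hom[OF m(1)]]])
      then have "(- shm T k) \<cdot> u = 0"
        using A unfolding heart_iff by (auto simp flip: sh_1)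
      then obtain v where v: "v \<in> Hom T M B" "u = c \<cdot> v"
        using dist_lift2[OF dist_rot[OF D] u] by blast
      obtain w where w: "w \<in> Hom T M A" "v = g \<cdot> w"
        using g v(1) unfolding surj_from_M_def by blast
      show "u = 0"
        using v w comp_assoc[OF w(1) gm m(2)] dist_comp_zero2[OF D] comp_zero_left[OF w(1)] by simp
    qed
    then show ?thesis
      using True by (simp add: sh_1)
  next
    case False
    have "orth M (sh T j V)" if "V \<in> \<H>" "j \<noteq> 0" for V j
      using that unfolding heart_iff by (cases j "0::int" rule: linorder_cases) auto
    then show ?thesis
      using dist_sh_orth_right(3)[OF D, of M "i - 1"] A B False that by simp
  qed
  then have K: "K \<in> \<H>"
    unfolding heart_iff by simp
  have "mono_in T \<H> K A k"
    unfolding mono_in_def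
  proof (intro conjI K A m ballI impI)
    fix W a b
    assume W: "W \<in> \<H>" and ab: "a \<in> Hom T W K" "b \<in> Hom T W K" and eq: "k \<cdot> a = k \<cdot> b"
    \<comment> \<open>B[-1], written as a preimage under the shift so that the triangle can be
      rotated backwards.\<close>
    obtain B' where B': "sh1 T B' = B"
      using sh1_inv by blast
    obtain f' where D': "dist T B' K A f' k g"
      using D unfolding B'[symmetric] by (rule dist_unrot)
    have f': "f' \<in> Hom T B' K"
      using dist_in_Hom[OF D'] by auto
    have "k \<cdot> (a - b) = 0"
      using comp_diff_right[OF ab m(1)] eq by simp
    then obtain v where v: "v \<in> Hom T W B'" "a - b = f' \<cdot> v"
      using dist_lift[OF D' diff_in_Hom[OF ab]] by blast
    have "orth (sh1 T W) (sh1 T B')"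
      using orth_lt0_ge0[OF lt0_sh1[of W], of B] W B by (simp add: B' heart_iff)
    then have "v = 0"
      using v(1) by (simp add: orth_sh1)
    then show "a = b"
      using v(2) comp_zero_right[OF f'] by simp
  qed
  then show ?thesis
    using that D by blast
qed

text \<open>Monomorphisms are tested on the heart, which need not contain \<open>M\<close>; its
  truncation \<open>Q\<close> serves as test object, since maps from \<open>M\<close> to the heart
  factor uniquely through it.\<close>

lemma mono_inj_from_M:
  assumes f: "mono_in T \<H> U E f" and m: "m \<in> Hom T M U" "f \<cdot> m = 0"
  shows "m = 0"
proof -
  obtain D Q d q h where D: "dist T D M Q d q h" "lt0 D" "Q \<in> \<H>"
    using truncate[OF le0_silting] .
  have U: "U \<in> \<H>" "E \<in> \<H>" "f \<in> Hom T U E"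
    and inj: "\<And>g g'. g \<in> Hom T Q U \<Longrightarrow> g' \<in> Hom T Q U \<Longrightarrow> f \<cdot> g = f \<cdot> g' \<Longrightarrow> g = g'"
    using f D(3) unfolding mono_in_def by blast+
  have q: "q \<in> Hom T M Q"
    using dist_in_Hom[OF D(1)] by auto
  obtain w where w: "w \<in> Hom T Q U" "m = w \<cdot> q"
    using heart_factor[OF D(1,2) U(1) m(1)] .
  have "f \<cdot> w = 0"
    using heart_cancel[OF D(1,2) U(2) comp_in_Hom[OF w(1) U(3)]] comp_assoc[OF q w(1) U(3)] m(2) w(2)
    by simp
  then have "w = 0"
    using inj[OF w(1) zero_in_Hom] comp_zero_right[OF U(3)] by simp
  then show ?thesis
    using w(2) comp_zero_left[OF q] by simp
qed

text \<open>The truncation \<open>Q\<close> of the cone is the cokernel, and S \<rightarrow> Q has a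
  kernel \<open>K\<close> in the heart. Simplicity leaves K = 0, excluded because then \<phi> = 0,
  or K = S; in the latter case the cokernel map is zero, which is surjectivity as seen by
  \<open>M\<close>.\<close>

lemma simple_surj_from_M:
  assumes Z: "le0 Z" and S: "simple_in T \<H> S" and \<phi>: "\<phi> \<in> Hom T Z S" "\<phi> \<noteq> 0"
  shows "surj_from_M Z S \<phi>"
proof -
  have S_heart: "S \<in> \<H>" and S_le0: "le0 S"
    and S_sub: "\<And>U f. mono_in T \<H> U S f \<Longrightarrow> zero_object T U \<or> is_iso T U S f"
    using S unfolding simple_in_def heart_iff by blast+
  obtain C c h where D: "dist T Z S C \<phi> c h"
    using ex_cone[OF \<phi>(1)] by blast
  have c: "c \<in> Hom T S C"
    using dist_in_Hom[OF D] by auto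
  obtain E Q e q h' where Q: "dist T E C Q e q h'" "lt0 E" "Q \<in> \<H>"
    using truncate[OF le0_cone[OF D Z S_le0]] .
  have q: "q \<in> Hom T C Q"
    using dist_in_Hom[OF Q(1)] by auto
  have "surj_from_M S C c"
    using surj_from_M_cone[OF D] Z[rule_format, of 1] by (simp add: sh_1)
  then have "surj_from_M S Q (q \<cdot> c)"
    using surj_from_M_comp surj_from_M_truncate[OF Q(1,2)] by blast
  then obtain K k h'' where K: "dist T K S Q k (q \<cdot> c) h''" "mono_in T \<H> K S k"
    using fibre_in_heart[OF S_heart Q(3)] by blast
  have qc: "q \<cdot> c \<in> Hom T S Q"
    by (rule comp_in_Hom[OF c q])
  have "\<not> zero_object T K"
  proof
    assume "zero_object T K"
    then obtain s where s: "s \<in> Hom T Q S" "s \<cdot> (q \<cdot> c) = Id T S"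
      using dist_zero_first_iso[OF K(1)] by blast
    have "\<phi> = s \<cdot> ((q \<cdot> c) \<cdot> \<phi>)"
      using comp_assoc[OF \<phi>(1) qc s(1)] s(2) comp_Id_left[OF \<phi>(1)] by simp
    also have "(q \<cdot> c) \<cdot> \<phi> = 0"
      using comp_assoc[OF \<phi>(1) c q] dist_comp_zero[OF D] comp_zero_right[OF q] by simp
    finally show False
      using \<phi>(2) comp_zero_right[OF s(1)] by simp
  qed
  then have "is_iso T K S k"
    using S_sub[OF K(2)] by blast
  then obtain l where l: "k \<in> Hom T K S" "l \<in> Hom T S K" "k \<cdot> l = Id T S"
    unfolding is_iso_def by blast
  have "q \<cdot> c = (q \<cdot> c) \<cdot> k \<cdot> l"
    using comp_assoc[OF l(2,1) qc] l(3) comp_Id_right[OF qc] by simp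
  then have qc0: "q \<cdot> c = 0"
    using dist_comp_zero[OF K(1)] comp_zero_left[OF l(2)] by simp
  show ?thesis
    unfolding surj_from_M_def
  proof (intro conjI \<phi>(1) ballI)
    fix m assume m: "m \<in> Hom T M S"
    \<comment> \<open>\<open>q\<close> is injective on maps from \<open>M\<close>, so vanishing in
      the cokernel gives vanishing in the cone, and \<open>m\<close> lifts.\<close>
    have "q \<cdot> (c \<cdot> m) = 0"
      using comp_assoc[OF m c q] qc0 comp_zero_left[OF m] by simp
    then have "c \<cdot> m = 0"
      using inj_from_M_truncate[OF Q(1,2) comp_in_Hom[OF m c]] by blast
    then show "\<exists>a\<in>Hom T M Z. m = \<phi> \<cdot> a"
      using dist_lift[OF D m] by blast
  qed
qed

lemma simple_nonzero: "simple_in T \<H> S \<Longrightarrow> \<not> orth M S"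
  using heart_nonzero unfolding simple_in_def by blast

text \<open>The cone lies in degrees \<le> -1 and has no maps to the heart, so nothing in the heart
  can distinguish maps that agree after \<phi>.\<close>

lemma simple_epi:
  assumes Z: "Z \<in> \<H>" and S: "simple_in T \<H> S" and \<phi>: "\<phi> \<in> Hom T Z S" "\<phi> \<noteq> 0"
  shows "epi_in T \<H> Z S \<phi>"
proof -
  have S_heart: "S \<in> \<H>"
    using S unfolding simple_in_def by blast
  obtain C c h where D: "dist T Z S C \<phi> c h"
    using ex_cone[OF \<phi>(1)] by blast
  have c: "c \<in> Hom T S C"
    using dist_in_Hom[OF D] by auto
  have le0: "le0 Z" "le0 S"
    using Z S_heart unfolding heart_iff by auto
  have "lt0 C"
    using surj_from_M_cone_lt0[OF D le0 simple_surj_from_M[OF le0(1) S \<phi>]] .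
  show ?thesis
    unfolding epi_in_def
  proof (intro conjI Z S_heart \<phi>(1) ballI impI)
    fix W a b
    assume W: "W \<in> \<H>" and ab: "a \<in> Hom T S W" "b \<in> Hom T S W" and eq: "a \<cdot> \<phi> = b \<cdot> \<phi>"
    have "(a - b) \<cdot> \<phi> = 0"
      using comp_diff_left[OF \<phi>(1) ab] eq by simp
    then obtain v where v: "v \<in> Hom T C W" "a - b = v \<cdot> c"
      using dist_extend[OF D diff_in_Hom[OF ab]] by blast
    have "orth C W"
      using orth_lt0_ge0[OF \<open>lt0 C\<close>] W heart_iff by blast
    then show "a = b"
      using v comp_zero_left[OF c] by simp
  qed
qed

text \<open>The kernel of \<open>r\<close> is a subobject of the simple \<open>S\<close>; if it were
  all of \<open>S\<close>, \<open>r\<close> would be zero. So it is zero and \<open>r\<close> is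
  invertible.\<close>

lemma schur:
  assumes S: "simple_in T \<H> S" and S': "simple_in T \<H> S'" and r: "r \<in> Hom T S S'" "r \<noteq> 0"
  obtains s where "s \<in> Hom T S' S" "r \<cdot> s = Id T S'"
proof -
  have heart: "S \<in> \<H>" "S' \<in> \<H>"
    using S S' unfolding simple_in_def by auto
  then have "surj_from_M S S' r"
    using simple_surj_from_M[OF _ S' r] heart_iff by blast
  then obtain K k h where K: "dist T K S S' k r h" "mono_in T \<H> K S k"
    using fibre_in_heart[OF heart] by blast
  have "\<not> is_iso T K S k"
  proof
    assume "is_iso T K S k"
    then obtain l where l: "k \<in> Hom T K S" "l \<in> Hom T S K" "k \<cdot> l = Id T S"
      unfolding is_iso_def by blast
    have "r = r \<cdot> k \<cdot> l"
      using comp_assoc[OF l(2,1) r(1)] l(3) comp_Id_right[OF r(1)] by simp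
    then show False
      using dist_comp_zero[OF K(1)] comp_zero_left[OF l(2)] r(2) by simp
  qed
  then have "zero_object T K"
    using S K(2) unfolding simple_in_def by blast
  then show ?thesis
    using dist_zero_first_iso[OF K(1)] that by blast
qed

end

section \<open>Simple quotients and tops\<close>

context linear_category
begin

text \<open>Steinitz exchange for a spanning set that may be dependent.\<close>

lemma span_exchange:
  assumes "finite B" "k \<in> span B" "k \<noteq> 0"
  obtains b where "b \<in> B" "b \<in> span (insert k (B - {b}))"
  using assms
proof (induction B arbitrary: thesis rule: finite_induct)
  case empty
  then show ?case by simp
next
  case (insert a B)
  show ?case
  proof (cases "k \<in> span B")
    case True
    then obtain b where b: "b \<in> B" "b \<in> span (insert k (B - {b}))"
      using insert.IH insert.prems(3) by blast
    have "insert k (B - {b}) \<subseteq> insert k (insert a B - {b})"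
      by blast
    then show ?thesis
      using insert.prems(1)[of b] b span_mono by blast
  next
    case False
    then have "a \<in> span (insert k (insert a B - {a}))"
      using in_span_insert[OF insert.prems(2)] insert.hyps(2) by simp
    then show ?thesis
      using insert.prems(1)[of a] by simp
  qed
qed

text \<open>Composition with \<open>g\<close> is linear only on the Hom space, not on the ambient
  space, so membership is carried through the induction.\<close>

lemma span_Hom_image:
  assumes "B \<subseteq> Hom C X Y" "g \<in> Hom C Y Z" "x \<in> span B"
  shows "x \<in> Hom C X Y \<and> g \<cdot> x \<in> span ((\<cdot>) g ` B)"
  using assms(3)
proof (induction rule: span_induct_alt)
  case base
  then show ?case
    using comp_zero_right[OF assms(2)] span_zero by simp
next
  case (step c b y)
  then have "b \<in> Hom C X Y" "y \<in> Hom C X Y"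
    using assms(1) by auto
  then show ?case
    using step comp_add_right[OF scl_in_Hom _ assms(2)] comp_scl_right[OF _ assms(2)]
    by (simp add: add_in_Hom scl_in_Hom span_add span_scale span_base)
qed

text \<open>Exchange a generator for the kernel element \<open>k\<close>, which then contributes
  nothing to the image. The size of a spanning set thus serves as the decreasing measure in
  \<open>simple_quotient\<close>.\<close>

lemma spanning_set_of_quotient:
  assumes B: "finite B" "span B = Hom C X Y" and g: "g \<in> Hom C Y Z"
    and surj: "\<forall>u\<in>Hom C X Z. \<exists>v\<in>Hom C X Y. u = g \<cdot> v"
    and k: "k \<in> Hom C X Y" "k \<noteq> 0" "g \<cdot> k = 0"
  obtains B' where "finite B'" "card B' < card B" "span B' = Hom C X Z"
proof -
  obtain b where b: "b \<in> B" "b \<in> span (insert k (B - {b}))"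
    using span_exchange[OF B(1)] k B(2) by blast
  have sub: "insert k (B - {b}) \<subseteq> Hom C X Y"
    using k(1) B(2) span_superset by blast
  have "B \<subseteq> span (insert k (B - {b}))"
    using b(2) span_superset[of "insert k (B - {b})"] by blast
  then have span: "Hom C X Y \<subseteq> span (insert k (B - {b}))"
    using span_minimal[OF _ subspace_span] B(2) by blast
  define B' where "B' = (\<cdot>) g ` (B - {b})"
  have image: "span ((\<cdot>) g ` insert k (B - {b})) = span B'"
    using k(3) by (simp add: B'_def span_insert_0)
  have "finite B'"
    using B(1) by (simp add: B'_def)
  moreover have "card B' < card B"
    unfolding B'_def
    by (metis B(1) b(1) card_Diff1_less card_image_le finite_Diff le_less_trans)
  moreover have "span B' = Hom C X Z"
  proof
    have "B' \<subseteq> Hom C X Z"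
      unfolding B'_def using sub comp_in_Hom[OF _ g] by blast
    then show "span B' \<subseteq> Hom C X Z"
      by (rule span_minimal[OF _ Hom_subspace])
    show "Hom C X Z \<subseteq> span B'"
    proof
      fix u assume "u \<in> Hom C X Z"
      then obtain v where "v \<in> Hom C X Y" "u = g \<cdot> v"
        using surj by blast
      then show "u \<in> span B'"
        using span_Hom_image[OF sub g, of v] span image by blast
    qed
  qed
  ultimately show ?thesis
    by (rule that)
qed

end

section \<open>Right approximations\<close>

context additive_linear_category
begin

text \<open>The source receives one copy of \<open>A\<close> for each map in \<open>B\<close>. The
  abstract \<open>P\<close> lets it inherit the properties wanted later, without describing it as an
  object of an additive closure.\<close>

lemma right_cover_finite:
  assumes zero: "\<And>W. zero_object C W \<Longrightarrow> P W"
    and sum: "\<And>U V W. direct_sum C [U, V] W \<Longrightarrow> P U \<Longrightarrow> P V \<Longrightarrow> P W"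
    and A: "P A" and B: "finite B" "B \<subseteq> Hom C A Z"
  shows "\<exists>W w. P W \<and> w \<in> Hom C W Z \<and> (\<forall>b\<in>B. \<exists>a\<in>Hom C A W. b = w \<cdot> a)"
  using B
proof (induction rule: finite_induct)
  case empty
  obtain K where "zero_object C K"
    using ex_zero_object by blast
  then show ?case
    using zero by (intro exI[of _ K] exI[of _ 0]) simp
next
  case (insert b B)
  then have b: "b \<in> Hom C A Z" and "B \<subseteq> Hom C A Z"
    by simp_all
  with insert.IH obtain W w where W: "P W" "w \<in> Hom C W Z" "\<forall>b\<in>B. \<exists>a\<in>Hom C A W. b = w \<cdot> a"
    by metis
  obtain V where V: "direct_sum C [W, A] V"
    using ex_direct_sum by blast
  obtain i j p q where m: "i \<in> Hom C W V" "j \<in> Hom C A V" "p \<in> Hom C V W" "q \<in> Hom C V A"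
    and eq: "p \<cdot> i = Id C W" "q \<cdot> j = Id C A" "p \<cdot> j = 0" "q \<cdot> i = 0"
    by (rule direct_sum_pairE[OF V])
  define v where "v = w \<cdot> p + b \<cdot> q"
  have wp: "w \<cdot> p \<in> Hom C V Z" and bq: "b \<cdot> q \<in> Hom C V Z"
    using comp_in_Hom[OF m(3) W(2)] comp_in_Hom[OF m(4) b] .
  have v: "v \<in> Hom C V Z"
    unfolding v_def by (rule add_in_Hom[OF wp bq])
  have vi: "v \<cdot> i = w"
    unfolding v_def using comp_add_left[OF m(1) wp bq] comp_assoc[OF m(1,3) W(2)]
      comp_assoc[OF m(1,4) b] eq comp_Id_right[OF W(2)] comp_zero_right[OF b] by simp
  have vj: "v \<cdot> j = b"
    unfolding v_def using comp_add_left[OF m(2) wp bq] comp_assoc[OF m(2,3) W(2)]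
      comp_assoc[OF m(2,4) b] eq comp_Id_right[OF b] comp_zero_right[OF W(2)] by simp
  have "\<exists>a\<in>Hom C A V. c = v \<cdot> a" if c: "c \<in> B" for c
  proof -
    obtain a where a: "a \<in> Hom C A W" "c = w \<cdot> a"
      using bspec[OF W(3) c] by (elim bexE)
    then have "c = v \<cdot> (i \<cdot> a)"
      using comp_assoc[OF a(1) m(1) v] vi by simp
    then show ?thesis
      using comp_in_Hom[OF a(1) m(1)] by (rule bexI)
  qed
  moreover have "\<exists>a\<in>Hom C A V. b = v \<cdot> a"
    using vj[symmetric] m(2) by (rule bexI)
  ultimately show ?case
    using sum[OF V W(1) A] v by (intro exI[of _ V] exI[of _ v]) simp
qed

lemma right_cover:
  assumes "Hom_finite C" and zero: "\<And>W. zero_object C W \<Longrightarrow> P W"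
    and sum: "\<And>U V W. direct_sum C [U, V] W \<Longrightarrow> P U \<Longrightarrow> P V \<Longrightarrow> P W" and A: "P A"
  obtains W w where "P W" "w \<in> Hom C W Z" "\<And>u. u \<in> Hom C A Z \<Longrightarrow> \<exists>a\<in>Hom C A W. u = w \<cdot> a"
proof -
  obtain B where B: "finite B" "span B = Hom C A Z"
    using assms(1) unfolding Hom_finite_def by blast
  then have BA: "B \<subseteq> Hom C A Z"
    using span_superset by blast
  have "\<exists>W w. P W \<and> w \<in> Hom C W Z \<and> (\<forall>b\<in>B. \<exists>a\<in>Hom C A W. b = w \<cdot> a)"
    by (rule right_cover_finite[of P, OF _ _ A B(1) BA]; (erule zero | erule (2) sum))
  then obtain W w where W: "P W" "w \<in> Hom C W Z" "\<forall>b\<in>B. \<exists>a\<in>Hom C A W. b = w \<cdot> a"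
    by (elim exE conjE)
  have "\<exists>a\<in>Hom C A W. u = w \<cdot> a" if "u \<in> span B" for u
    using that
  proof (induction rule: span_induct_alt)
    case base
    then show ?case
      using comp_zero_right[OF W(2)] by (intro bexI[of _ 0]) simp_all
  next
    case (step c b y)
    obtain a a' where a: "a \<in> Hom C A W" "b = w \<cdot> a" "a' \<in> Hom C A W" "y = w \<cdot> a'"
      using bspec[OF W(3) step(1)] step(2) by (elim bexE) (rule that)
    then have "scl C c b + y = w \<cdot> (scl C c a + a')"
      using comp_add_right[OF scl_in_Hom[OF a(1)] a(3) W(2)] comp_scl_right[OF a(1) W(2)] by simp
    then show ?case
      using add_in_Hom[OF scl_in_Hom[OF a(1)] a(3)] by (rule bexI)
  qed
  then show ?thesis
    using that[OF W(1,2)] by (simp only: B(2))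
qed

end

text \<open>\<open>b \<cdot> a\<close> fixes the nonzero \<open>g\<close>, so
  \<open>Id C Q - b \<cdot> a\<close> cannot be invertible; in a local ring
  \<open>b \<cdot> a\<close> then is.\<close>

lemma (in linear_category) local_End_retract:
  assumes Q: "local_End C Q" and ab: "a \<in> Hom C Q X" "b \<in> Hom C X Q"
    and g: "g \<in> Hom C Q S" "g \<noteq> 0" "g \<cdot> (b \<cdot> a) = g"
  obtains p where "p \<in> Hom C X Q" "p \<cdot> a = Id C Q"
proof -
  define e where "e = b \<cdot> a"
  have e: "e \<in> Hom C Q Q"
    unfolding e_def by (rule comp_in_Hom[OF ab])
  have e': "Id C Q - e \<in> Hom C Q Q"
    by (rule diff_in_Hom[OF Id_in_Hom e])
  have g0: "g \<cdot> (Id C Q - e) = 0"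
    using comp_diff_right[OF Id_in_Hom e g(1)] comp_Id_right[OF g(1)] g(3) by (simp add: e_def)
  have "\<not> is_iso C Q Q (Id C Q - e)"
  proof
    assume "is_iso C Q Q (Id C Q - e)"
    then obtain l where l: "l \<in> Hom C Q Q" "(Id C Q - e) \<cdot> l = Id C Q"
      unfolding is_iso_def by blast
    have "g = (g \<cdot> (Id C Q - e)) \<cdot> l"
      using comp_assoc[OF l(1) e' g(1)] l(2) comp_Id_right[OF g(1)] by simp
    then show False
      using g0 g(2) comp_zero_left[OF l(1)] by simp
  qed
  moreover have "is_iso C Q Q (e + (Id C Q - e))"
    unfolding is_iso_def using Id_in_Hom[of Q] comp_Id_left[OF Id_in_Hom] by auto
  ultimately have "is_iso C Q Q e"
    using Q e e' unfolding local_End_def by blast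
  then obtain l where l: "l \<in> Hom C Q Q" "l \<cdot> e = Id C Q"
    unfolding is_iso_def by blast
  then show ?thesis
    using that[OF comp_in_Hom[OF ab(2) l(1)]] comp_assoc[OF ab l(1)] by (simp add: e_def)
qed

lemma (in triangulated_category) retract_in_add_closure:
  assumes "i \<in> Hom T Q X" "p \<in> Hom T X Q" "p \<cdot> i = Id T Q"
  shows "Q \<in> add_closure T X"
proof -
  obtain C where "direct_sum T [Q, C] X"
    using retract_complement[OF assms] by blast
  moreover have "direct_sum T (replicate 1 X) X"
    using direct_sum_singleton by simp
  ultimately show ?thesis
    unfolding add_closure_def by blast
qed

section \<open>Existence of simple quotients in the heart\<close>

context silting_t_structure
begin

text \<open>No Hom(M, C[i]) survives for the cone: degree 0 by hypothesis, degree -1 because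
  \<open>f\<close> is injective on Hom(M,-) and Hom(M, E[-1]) = 0, the rest by the long exact
  sequence. Since \<open>M\<close> generates, the cone is zero; the proof argues with its
  desuspension \<open>C'\<close>.\<close>

lemma mono_iso_of_orth_cone:
  assumes f: "mono_in T \<H> U E f" and D: "dist T U E C f c h" and C: "orth M C"
  shows "is_iso T U E f"
proof -
  have m: "f \<in> Hom T U E" and heart: "U \<in> \<H>" "E \<in> \<H>"
    using f unfolding mono_in_def by auto
  have heart0: "orth M (sh T j V)" if "V \<in> \<H>" "j \<noteq> 0" for V j
    using that unfolding heart_iff by (cases j "0::int" rule: linorder_cases) auto
  obtain C' where C': "sh1 T C' = C"
    using sh1_inv by blast
  obtain c' where D': "dist T C' U E c' f c"
    using D unfolding C'[symmetric] by (rule dist_unrot)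
  obtain E' where E': "sh1 T E' = E"
    using sh1_inv by blast
  obtain e where D'': "dist T E' C' U e c' f"
    using D' unfolding E'[symmetric] by (rule dist_unrot)
  have c': "c' \<in> Hom T C' U" and e: "e \<in> Hom T E' C'"
    using dist_in_Hom[OF D''] by auto
  have "sh T (- 1) E = E'"
    using sh_sh1[of "- 1" E'] E' by simp
  then have "orth M E'"
    using heart0[OF heart(2), of "- 1"] by simp
  have "orth M C'"
  proof (rule orthI)
    fix u assume u: "u \<in> Hom T M C'"
    have "f \<cdot> (c' \<cdot> u) = 0"
      using comp_assoc[OF u c' m] dist_comp_zero[OF D'] comp_zero_left[OF u] by simp
    then have "c' \<cdot> u = 0"
      by (rule mono_inj_from_M[OF f comp_in_Hom[OF u c']])
    then obtain v where "v \<in> Hom T M E'" "u = e \<cdot> v"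
      using dist_lift[OF D'' u] by blast
    then show "u = 0"
      using \<open>orth M E'\<close> comp_zero_right[OF e] by simp
  qed
  have "orth M (sh T i C')" for i
  proof -
    consider "i = 0" | "i = 1" | "i \<noteq> 0" "i - 1 \<noteq> 0"
      by linarith
    then show ?thesis
    proof cases
      case 1
      then show ?thesis using \<open>orth M C'\<close> by simp
    next
      case 2
      then show ?thesis using C C' by (simp add: sh_1)
    next
      case 3
      then show ?thesis
        using dist_sh_orth_right(3)[OF D', of M "i - 1"] heart0 heart by simp
    qed
  qed
  then have "zero_object T C'"
    by (rule orth_generator_imp_zero)
  then show ?thesis
    using dist_zero_first_iso[OF D'] m unfolding is_iso_def by blast
qed

text \<open>If \<open>E\<close> is not simple, pass to its quotient \<open>Q\<close> by a nonzero
  proper subobject \<open>U\<close>. It is nonzero because \<open>U\<close> is proper, and Hom(M, Q)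
  needs fewer generators because \<open>U\<close> is nonzero.\<close>

lemma simple_quotient:
  assumes "E \<in> \<H>" "\<not> zero_object T E" "finite B" "span B = Hom T M E"
  shows "\<exists>S q. simple_in T \<H> S \<and> q \<in> Hom T E S \<and> q \<noteq> 0"
  using assms
proof (induction "card B" arbitrary: E B rule: less_induct)
  case less
  show ?case
  proof (cases "simple_in T \<H> E")
    case True
    then show ?thesis
      using Id_in_Hom[of E] less.prems(2) zero_object_iff_Id[of E] by metis
  next
    case False
    then obtain U f where f: "mono_in T \<H> U E f" "\<not> zero_object T U" "\<not> is_iso T U E f"
      using less.prems(1,2) unfolding simple_in_def by blast
    have fm: "f \<in> Hom T U E" and U: "U \<in> \<H>"
      using f(1) unfolding mono_in_def by auto
    obtain C c h where D: "dist T U E C f c h"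
      using ex_cone[OF fm] by blast
    have c: "c \<in> Hom T E C"
      using dist_in_Hom[OF D] by auto
    have le0: "le0 U" "le0 E"
      using U less.prems(1) heart_iff by auto
    obtain A Q a q h' where Q: "dist T A C Q a q h'" "lt0 A" "Q \<in> \<H>"
      using truncate[OF le0_cone[OF D le0]] .
    have q: "q \<in> Hom T C Q"
      using dist_in_Hom[OF Q(1)] by auto
    have "surj_from_M E C c"
      using surj_from_M_cone[OF D] le0(1)[rule_format, of 1] by (simp add: sh_1)
    then have qc: "surj_from_M E Q (q \<cdot> c)"
      using surj_from_M_comp surj_from_M_truncate[OF Q(1,2)] by blast
    have qcm: "q \<cdot> c \<in> Hom T E Q"
      by (rule comp_in_Hom[OF c q])
    have "\<not> zero_object T Q"
    proof
      assume "zero_object T Q"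
      then have "orth M Q"
        unfolding zero_object_def by blast
      have "orth M C"
      proof (rule orthI)
        fix m assume m: "m \<in> Hom T M C"
        then have "q \<cdot> m = 0"
          using comp_in_Hom[OF m q] \<open>orth M Q\<close> by simp
        then show "m = 0"
          using inj_from_M_truncate[OF Q(1,2) m] by blast
      qed
      then show False
        using mono_iso_of_orth_cone[OF f(1) D] f(3) by blast
    qed
    \<comment> \<open>The composite \<open>f \<cdot> u\<close> will be the nonzero element of Hom(M,
      E) that dies in \<open>Q\<close>.\<close>
    obtain u where u: "u \<in> Hom T M U" "u \<noteq> 0"
      using heart_nonzero[OF U f(2)] orthI by blast
    have k: "f \<cdot> u \<in> Hom T M E" "f \<cdot> u \<noteq> 0"
      using comp_in_Hom[OF u(1) fm] mono_inj_from_M[OF f(1) u(1)] u(2) by auto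
    have "(q \<cdot> c) \<cdot> (f \<cdot> u) = q \<cdot> ((c \<cdot> f) \<cdot> u)"
      using comp_assoc[OF k(1) c q] comp_assoc[OF u(1) fm c] by simp
    then have "(q \<cdot> c) \<cdot> (f \<cdot> u) = 0"
      using dist_comp_zero[OF D] comp_zero_left[OF u(1)] comp_zero_right[OF q] by simp
    then obtain B' where B': "finite B'" "card B' < card B" "span B' = Hom T M Q"
      using spanning_set_of_quotient[OF less.prems(3,4) qcm _ k] qc unfolding surj_from_M_def by blast
    obtain S r where S: "simple_in T \<H> S" "r \<in> Hom T Q S" "r \<noteq> 0"
      using less.hyps[OF B'(2) Q(3) \<open>\<not> zero_object T Q\<close> B'(1,3)] by blast
    have "surj_from_M E S (r \<cdot> (q \<cdot> c))"
      using surj_from_M_comp[OF qc simple_surj_from_M[OF _ S]] Q(3) heart_iff by blast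
    then have rqc: "r \<cdot> (q \<cdot> c) \<in> Hom T E S" "\<And>u. u \<in> Hom T M S \<Longrightarrow> \<exists>a\<in>Hom T M E. u = r \<cdot> (q \<cdot> c) \<cdot> a"
      unfolding surj_from_M_def by blast+
    moreover have "r \<cdot> (q \<cdot> c) \<noteq> 0"
    proof
      assume "r \<cdot> (q \<cdot> c) = 0"
      then have "orth M S"
        using rqc(2) comp_zero_left by (intro orthI) auto
      then show False
        using simple_nonzero[OF S(1)] by blast
    qed
    ultimately show ?thesis
      using S(1) by blast
  qed
qed

lemma le0_retract:
  assumes "i \<in> Hom T Q W" "p \<in> Hom T W Q" "p \<cdot> i = Id T Q" "le0 W"
  shows "le0 Q"
proof (intro allI impI)
  fix j :: int assume "0 < j"
  then have "orth (sh T (- j) M) W"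
    by (rule iffD1[OF orth_sh_move assms(4)[rule_format]])
  then show "orth M (sh T j Q)"
    by (rule iffD2[OF orth_sh_move orth_retract_right[OF assms(1-3)]])
qed

text \<open>Projectivity of the summands of \<open>M\<close>: extend \<open>y\<close> to
  \<open>M\<close> by the projection, lift, and restrict.\<close>

lemma surj_from_retract:
  assumes "i \<in> Hom T V M" "p \<in> Hom T M V" "p \<cdot> i = Id T V"
    and \<phi>: "surj_from_M Z S \<phi>" and y: "y \<in> Hom T V S"
  obtains a where "a \<in> Hom T V Z" "y = \<phi> \<cdot> a"
proof -
  have \<phi>m: "\<phi> \<in> Hom T Z S"
    using \<phi> unfolding surj_from_M_def by blast
  obtain m where m: "m \<in> Hom T M Z" "y \<cdot> p = \<phi> \<cdot> m"
    using \<phi> comp_in_Hom[OF assms(2) y] unfolding surj_from_M_def by blast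
  have "y = (y \<cdot> p) \<cdot> i"
    using comp_assoc[OF assms(1,2) y] assms(3) comp_Id_right[OF y] by simp
  also have "\<dots> = \<phi> \<cdot> (m \<cdot> i)"
    using m(2) comp_assoc[OF assms(1) m(1) \<phi>m] by simp
  finally show ?thesis
    by (rule that[OF comp_in_Hom[OF assms(1) m(1)]])
qed

end

section \<open>The two summands of M and the top of H^0 X\<close>

locale silting_decomposition = silting_t_structure T M
  for T :: "('k::field, 'o, 'm::ab_group_add, 'z) tri_cat_scheme" (structure) and M :: 'o +
  fixes X X' :: 'o
  assumes Hom_fin: "Hom_finite T" and KS: "Krull_Schmidt T"
    and decomposition: "direct_sum T [X, X'] M"
    and disjoint: "add_closure T X \<inter> add_closure T X' = {Z. zero_object T Z}"
begin

lemma X_retract: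
  obtains i p where "i \<in> Hom T X M" "p \<in> Hom T M X" "p \<cdot> i = Id T X"
  by (rule direct_sum_pairE[OF decomposition]) (rule that)

lemma X'_retract:
  obtains i p where "i \<in> Hom T X' M" "p \<in> Hom T M X'" "p \<cdot> i = Id T X'"
  by (rule direct_sum_pairE[OF decomposition]) (rule that)

lemma le0_X: "le0 X"
proof -
  obtain i p where "i \<in> Hom T X M" "p \<in> Hom T M X" "p \<cdot> i = Id T X"
    by (rule X_retract)
  then show ?thesis
    using le0_silting by (rule le0_retract)
qed

lemma le0_X': "le0 X'"
proof -
  obtain i p where "i \<in> Hom T X' M" "p \<in> Hom T M X'" "p \<cdot> i = Id T X'"
    by (rule X'_retract)
  then show ?thesis
    using le0_silting by (rule le0_retract)
qed

text \<open>
  A nonzero map to \<open>S\<close> from an indecomposable summand \<open>Q\<close> of \<open>X'\<close> and a nonzero map \<open>X \<rightarrow> S\<close> factor through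
  each other; as \<open>End(Q)\<close> is local, \<open>Q\<close> is then also a summand of \<open>X\<close>.
\<close>

lemma orth_X'_simple:
  assumes S: "simple_in T \<H> S" and x: "x \<in> Hom T X S" "x \<noteq> 0"
  shows "orth X' S"
proof (rule orthI, rule ccontr)
  fix g assume g: "g \<in> Hom T X' S" "g \<noteq> 0"
  obtain Ys where Ys: "\<And>Y. Y \<in> set Ys \<Longrightarrow> local_End T Y" "direct_sum T Ys X'"
    using KS unfolding Krull_Schmidt_def by blast
  obtain Q i p where Q: "Q \<in> set Ys" "i \<in> Hom T Q X'" "p \<in> Hom T X' Q" "p \<cdot> i = Id T Q" "g \<cdot> i \<noteq> 0"
    by (rule direct_sum_nonzero_left[OF Ys(2) g])
  have gi: "g \<cdot> i \<in> Hom T Q S"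
    by (rule comp_in_Hom[OF Q(2) g(1)])
  obtain j q where jq: "j \<in> Hom T X' M" "q \<in> Hom T M X'" "q \<cdot> j = Id T X'"
    by (rule X'_retract)
  have QM: "j \<cdot> i \<in> Hom T Q M" "p \<cdot> q \<in> Hom T M Q"
    using comp_in_Hom[OF Q(2) jq(1)] comp_in_Hom[OF jq(2) Q(3)] .
  have "(p \<cdot> q) \<cdot> (j \<cdot> i) = p \<cdot> ((q \<cdot> j) \<cdot> i)"
    using comp_assoc[OF QM(1) jq(2) Q(3)] comp_assoc[OF Q(2) jq(1,2)] by simp
  then have QM': "(p \<cdot> q) \<cdot> (j \<cdot> i) = Id T Q"
    using jq(3) comp_Id_left[OF Q(2)] Q(4) by simp
  have "surj_from_M X S x"
    by (rule simple_surj_from_M[OF le0_X S x])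
  then obtain a where a: "a \<in> Hom T Q X" "g \<cdot> i = x \<cdot> a"
    using surj_from_retract[OF QM QM' _ gi] by blast
  have "surj_from_M Q S (g \<cdot> i)"
    by (rule simple_surj_from_M[OF le0_retract[OF Q(2-4) le0_X'] S gi Q(5)])
  moreover obtain k l where "k \<in> Hom T X M" "l \<in> Hom T M X" "l \<cdot> k = Id T X"
    by (rule X_retract)
  ultimately obtain b where b: "b \<in> Hom T X Q" "x = (g \<cdot> i) \<cdot> b"
    using surj_from_retract x(1) by metis
  have "(g \<cdot> i) \<cdot> (b \<cdot> a) = g \<cdot> i"
    using a b comp_assoc[OF a(1) b(1) gi] by simp
  then obtain r where r: "r \<in> Hom T X Q" "r \<cdot> a = Id T Q"
    using local_End_retract[OF Ys(1)[OF Q(1)] a(1) b(1) gi Q(5)] by blast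
  have "Q \<in> add_closure T X \<inter> add_closure T X'"
    using retract_in_add_closure[OF a(1) r] retract_in_add_closure[OF Q(2-4)] by blast
  then have "zero_object T Q"
    using disjoint by blast
  then show False
    using Q(5) gi unfolding zero_object_def by blast
qed

text \<open>\<open>is_H0\<close> permits arbitrary truncations. As \<open>X\<close> is already in
  the aisle, the first one changes it only up to isomorphism, and the second reflects it into the
  heart.\<close>

lemma H0_map:
  assumes H: "is_H0 T M X H" and "H \<in> \<H>"
  obtains e where "e \<in> Hom T X H"
    "\<And>W u. W \<in> \<H> \<Longrightarrow> u \<in> Hom T X W \<Longrightarrow> \<exists>w\<in>Hom T H W. u = w \<cdot> e"
    "\<And>W w. W \<in> \<H> \<Longrightarrow> w \<in> Hom T H W \<Longrightarrow> w \<cdot> e = 0 \<Longrightarrow> w = 0"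
proof -
  obtain A B A' f g h f' g' h' where A: "le0 A" and B: "ge0 (sh T 1 B)"
    and D: "dist T A X B f g h" and A': "le0 (sh T (- 1) A')" and D': "dist T A' A H f' g' h'"
    using H unfolding is_H0_def truncation_def trunc_class_def silt_le0_def silt_ge0_def by auto
  have "lt0 A'"
  proof (intro allI impI)
    fix i :: int assume "0 \<le> i"
    then have "orth M (sh T (i + 1) (sh T (- 1) A'))"
      using A' by simp
    then show "orth M (sh T i A')"
      by (simp flip: sh_add)
  qed
  have ge0: "ge0 (sh1 T B)"
    using B by (simp add: sh_1)
  have m: "f \<in> Hom T A X" "g \<in> Hom T X B" "h \<in> Hom T B (sh1 T A)" "g' \<in> Hom T A H"
    using dist_in_Hom[OF D] dist_in_Hom[OF D'] by auto
  have "orth (sh1 T X) (sh1 T B)"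
    using orth_lt0_ge0[OF lt0_sh1[OF le0_X] ge0] .
  then have "g = 0"
    using m(2) by (simp add: orth_sh1)
  \<comment> \<open>Since \<open>g = 0\<close>, the identity of \<open>B\<close> factors through
    \<open>h\<close> and then through a map A[1] \<rightarrow> B; there is no nonzero such map, so
    \<open>B\<close> is zero.\<close>
  have "orth (sh1 T A) B"
  proof (rule orth_lt0_ge0[OF lt0_sh1[OF A]], intro allI impI)
    fix i :: int assume "i < 0"
    then show "orth M (sh T i B)"
      using ge0[rule_format, of "i - 1"] by (simp add: sh_sh1)
  qed
  moreover obtain v where "v \<in> Hom T (sh1 T A) B" "Id T B = v \<cdot> h"
    using dist_extend2[OF D Id_in_Hom] \<open>g = 0\<close> comp_zero_right[OF Id_in_Hom] by metis
  ultimately have "Id T B = 0"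
    using comp_zero_left[OF m(3)] by simp
  obtain B' where B': "sh1 T B' = B"
    using sh1_inv by blast
  obtain x where D'': "dist T B' A X x f g"
    using D unfolding B'[symmetric] by (rule dist_unrot)
  have "shm T (Id T B') = shm T 0"
    using \<open>Id T B = 0\<close> B' by (simp add: shm_Id shm_zero)
  then have "zero_object T B'"
    using shm_inject[OF Id_in_Hom zero_in_Hom] zero_object_iff_Id by blast
  then obtain s where s: "s \<in> Hom T X A" "s \<cdot> f = Id T A" "f \<cdot> s = Id T X"
    using dist_zero_first_iso[OF D''] by blast
  show ?thesis
  proof (rule that[OF comp_in_Hom[OF s(1) m(4)]])
    fix W u assume W: "W \<in> \<H>" and u: "u \<in> Hom T X W"
    obtain w where w: "w \<in> Hom T H W" "u \<cdot> f = w \<cdot> g'"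
      by (rule heart_factor[OF D' \<open>lt0 A'\<close> W comp_in_Hom[OF m(1) u]])
    have "u = (u \<cdot> f) \<cdot> s"
      using comp_assoc[OF s(1) m(1) u] s(3) comp_Id_right[OF u] by simp
    then show "\<exists>w\<in>Hom T H W. u = w \<cdot> (g' \<cdot> s)"
      using w comp_assoc[OF s(1) m(4) w(1)] by auto
  next
    fix W w assume W: "W \<in> \<H>" and w: "w \<in> Hom T H W" "w \<cdot> (g' \<cdot> s) = 0"
    have wg: "w \<cdot> g' \<in> Hom T A W"
      by (rule comp_in_Hom[OF m(4) w(1)])
    have "w \<cdot> g' = ((w \<cdot> g') \<cdot> s) \<cdot> f"
      using comp_assoc[OF m(1) s(1) wg] s(2) comp_Id_right[OF wg] by simp
    also have "(w \<cdot> g') \<cdot> s = 0"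
      using comp_assoc[OF s(1) m(4) w(1)] w(2) by simp
    finally have "w \<cdot> g' = 0"
      using comp_zero_left[OF m(1)] by simp
    then show "w = 0"
      by (rule heart_cancel[OF D' \<open>lt0 A'\<close> W w(1)])
  qed
qed

text \<open>Each simple summand S' of the top receives a nonzero map from \<open>X\<close>, the
  composite X \<rightarrow> H \<rightarrow> S \<rightarrow> S', so it receives none from
  \<open>X'\<close>.\<close>

lemma orth_X'_top:
  assumes H: "is_H0 T M X H" and S: "is_top T \<H> H S"
  shows "orth X' S"
proof -
  obtain p Ss where p: "epi_in T \<H> H S p" and Ss: "\<And>S'. S' \<in> set Ss \<Longrightarrow> simple_in T \<H> S'" "direct_sum T Ss S"
    using S unfolding is_top_def semisimple_in_def by blast
  have heart: "H \<in> \<H>" "S \<in> \<H>" and pm: "p \<in> Hom T H S"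
    using p unfolding epi_in_def by auto
  obtain e where e: "e \<in> Hom T X H" "\<And>W w. W \<in> \<H> \<Longrightarrow> w \<in> Hom T H W \<Longrightarrow> w \<cdot> e = 0 \<Longrightarrow> w = 0"
    using H0_map[OF H heart(1)] by metis
  show ?thesis
  proof (rule orthI, rule ccontr)
    fix u assume u: "u \<in> Hom T X' S" "u \<noteq> 0"
    obtain S' i q where S': "S' \<in> set Ss" "i \<in> Hom T S' S" "q \<in> Hom T S S'" "q \<cdot> u \<noteq> 0"
      using direct_sum_nonzero_right[OF Ss(2) u] by metis
    have S'_heart: "S' \<in> \<H>"
      using Ss(1)[OF S'(1)] unfolding simple_in_def by blast
    have "q \<noteq> 0"
      using S'(4) comp_zero_left[OF u(1)] by blast
    then have "q \<cdot> p \<noteq> 0"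
      using p S'_heart S'(3) comp_zero_left[OF pm] zero_in_Hom unfolding epi_in_def by metis
    then have "(q \<cdot> p) \<cdot> e \<noteq> 0"
      using e(2)[OF S'_heart comp_in_Hom[OF pm S'(3)]] by blast
    then have "orth X' S'"
      using orth_X'_simple[OF Ss(1)[OF S'(1)] comp_in_Hom[OF e(1) comp_in_Hom[OF pm S'(3)]]] by blast
    then show False
      using S'(4) comp_in_Hom[OF u(1) S'(3)] by simp
  qed
qed

text \<open>Both directions exploit that a simple object without maps from \<open>X'\<close> has a
  nonzero map from \<open>X\<close>, because \<open>M\<close> detects it.\<close>

lemma orth_top_iff_factors:
  assumes H: "is_H0 T M X H" and S: "is_top T \<H> H S"
    and f: "left_approximation T (add_closure T X') X X0 f" and Z: "le0 Z"
  shows "orth Z S \<longleftrightarrow> (\<forall>u\<in>Hom T X Z. \<exists>v\<in>Hom T X0 Z. u = v \<cdot> f)"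
proof
  have X0: "X0 \<in> add_closure T X'" and fm: "f \<in> Hom T X X0"
    and "\<forall>W\<in>add_closure T X'. \<forall>u\<in>Hom T X W. \<exists>v\<in>Hom T X0 W. u = v \<cdot> f"
    using f unfolding left_approximation_def by simp_all
  then have app: "\<forall>u\<in>Hom T X X'. \<exists>v\<in>Hom T X0 X'. u = v \<cdot> f"
    using self_in_add_closure[of X'] by simp
  obtain p where "semisimple_in T \<H> S" and p: "epi_in T \<H> H S p"
    and univ: "\<forall>Q q. semisimple_in T \<H> Q \<longrightarrow> epi_in T \<H> H Q q \<longrightarrow> (\<exists>r\<in>Hom T S Q. q = r \<cdot> p)"
    using S unfolding is_top_def by (elim conjE exE)
  obtain Ss where Ss: "\<And>S'. S' \<in> set Ss \<Longrightarrow> simple_in T \<H> S'" "direct_sum T Ss S"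
    using \<open>semisimple_in T \<H> S\<close> unfolding semisimple_in_def by blast
  have heart: "H \<in> \<H>" "S \<in> \<H>" and pm: "p \<in> Hom T H S"
    using p unfolding epi_in_def by auto
  {
    assume factor: "\<forall>u\<in>Hom T X Z. \<exists>v\<in>Hom T X0 Z. u = v \<cdot> f"
    have X0S: "orth X0 S" and X'S: "orth X' S"
      by (rule orth_add_closure_left[OF X0 orth_X'_top[OF H S]], rule orth_X'_top[OF H S])
    show "orth Z S"
    proof (rule orthI, rule ccontr)
      fix \<phi> assume \<phi>: "\<phi> \<in> Hom T Z S" "\<phi> \<noteq> 0"
      obtain S' i q where S': "S' \<in> set Ss" "i \<in> Hom T S' S" "q \<in> Hom T S S'" "q \<cdot> i = Id T S'" "q \<cdot> \<phi> \<noteq> 0"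
        by (rule direct_sum_nonzero_right[OF Ss(2) \<phi>])
      have q\<phi>: "q \<cdot> \<phi> \<in> Hom T Z S'"
        by (rule comp_in_Hom[OF \<phi>(1) S'(3)])
      have surj: "surj_from_M Z S' (q \<cdot> \<phi>)"
        by (rule simple_surj_from_M[OF Z Ss(1)[OF S'(1)] q\<phi> S'(5)])
      have "orth X0 S'" "orth X' S'"
        by (rule orth_retract_right[OF S'(2-4) X0S], rule orth_retract_right[OF S'(2-4) X'S])
      \<comment> \<open>A nonzero map X \<rightarrow> S' lifts to \<open>Z\<close>. Factoring the
        lift through \<open>f\<close> would make it pass through Hom(X0, S') = 0.\<close>
      then have "\<not> orth X S'"
        using simple_nonzero[OF Ss(1)[OF S'(1)]] orth_pair_left_iff[OF decomposition, of S'] by simp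
      then obtain x where x: "x \<in> Hom T X S'" "x \<noteq> 0"
        using orthI by blast
      obtain k l where "k \<in> Hom T X M" "l \<in> Hom T M X" "l \<cdot> k = Id T X"
        by (rule X_retract)
      then obtain u where u: "u \<in> Hom T X Z" "x = (q \<cdot> \<phi>) \<cdot> u"
        by (rule surj_from_retract[OF _ _ _ surj x(1)]) (rule that)
      obtain v where v: "v \<in> Hom T X0 Z" "u = v \<cdot> f"
        using factor u(1) by blast
      have "(q \<cdot> \<phi>) \<cdot> v = 0"
        using comp_in_Hom[OF v(1) q\<phi>] \<open>orth X0 S'\<close> by simp
      then have "x = 0"
        using u(2) v(2) comp_assoc[OF fm v(1) q\<phi>] comp_zero_left[OF fm] by simp
      then show False
        using x(2) by simp
    qed
  next
    assume ZS: "orth Z S"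
    \<comment> \<open>What is needed of the source of the approximation of \<open>Z\<close>: a cone
      in the aisle, and factorization of maps from \<open>X\<close>. Both hold for \<open>X'\<close>
      and survive finite sums.\<close>
    define P where "P W \<longleftrightarrow> le0 W \<and> (\<forall>x\<in>Hom T X W. \<exists>y\<in>Hom T X0 W. x = y \<cdot> f)" for W
    have P_zero: "P W" if "zero_object T W" for W
    proof -
      have "orth (sh T (- i) M) W" for i
        using that unfolding zero_object_def by blast
      then have "le0 W"
        by (simp add: orth_sh_move)
      moreover have "x = 0 \<cdot> f" if "x \<in> Hom T X W" for x
        using that \<open>zero_object T W\<close> comp_zero_left[OF fm] unfolding zero_object_def by auto
      ultimately show ?thesis
        unfolding P_def using zero_in_Hom by blast
    qed
    have P_sum: "P W" if W: "direct_sum T [U, V] W" and U: "P U" and V: "P V" for U V W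
    proof -
      obtain i j p q where m: "i \<in> Hom T U W" "j \<in> Hom T V W" "p \<in> Hom T W U" "q \<in> Hom T W V"
        and eq: "i \<cdot> p + j \<cdot> q = Id T W"
        by (rule direct_sum_pairE[OF W])
      have "le0 W"
      proof (intro allI impI)
        fix n :: int assume "0 < n"
        then have "orth (sh T (- n) M) U" "orth (sh T (- n) M) V"
          using U V by (simp_all add: P_def flip: orth_sh_move)
        then show "orth M (sh T n W)"
          by (simp add: orth_sh_move orth_pair_right_iff[OF W])
      qed
      moreover have "\<exists>y\<in>Hom T X0 W. x = y \<cdot> f" if x: "x \<in> Hom T X W" for x
      proof -
        obtain y where y: "y \<in> Hom T X0 U" "p \<cdot> x = y \<cdot> f"
          using U comp_in_Hom[OF x m(3)] unfolding P_def by blast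
        obtain z where z: "z \<in> Hom T X0 V" "q \<cdot> x = z \<cdot> f"
          using V comp_in_Hom[OF x m(4)] unfolding P_def by blast
        have "x = (i \<cdot> p) \<cdot> x + (j \<cdot> q) \<cdot> x"
          using comp_add_left[OF x comp_in_Hom[OF m(3,1)] comp_in_Hom[OF m(4,2)]] eq comp_Id_left[OF x]
          by simp
        also have "\<dots> = i \<cdot> y \<cdot> f + j \<cdot> z \<cdot> f"
          using comp_assoc[OF x m(3,1)] comp_assoc[OF x m(4,2)] y(2) z(2)
            comp_assoc[OF fm y(1) m(1)] comp_assoc[OF fm z(1) m(2)] by simp
        also have "\<dots> = (i \<cdot> y + j \<cdot> z) \<cdot> f"
          using comp_add_left[OF fm comp_in_Hom[OF y(1) m(1)] comp_in_Hom[OF z(1) m(2)]] by simp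
        finally show ?thesis
          using add_in_Hom[OF comp_in_Hom[OF y(1) m(1)] comp_in_Hom[OF z(1) m(2)]] by blast
      qed
      ultimately show ?thesis
        unfolding P_def by blast
    qed
    have "P X'"
      unfolding P_def using le0_X' app by (rule conjI)
    obtain W w where PW: "P W" and w: "w \<in> Hom T W Z"
      and cover: "\<And>u. u \<in> Hom T X' Z \<Longrightarrow> \<exists>a\<in>Hom T X' W. u = w \<cdot> a"
      by (rule right_cover[of P, OF Hom_fin _ _ \<open>P X'\<close>]) (erule P_zero, erule (2) P_sum, rule that)
    have W: "le0 W"
      using PW unfolding P_def by blast
    obtain C c h where D: "dist T W Z C w c h"
      using ex_cone[OF w] by blast
    have m: "c \<in> Hom T Z C" "h \<in> Hom T C (sh1 T W)"
      using dist_in_Hom[OF D] by auto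
    have "orth M (sh1 T W)"
      using W[rule_format, of 1] by (simp add: sh_1)
    then have X'W: "orth X' (sh1 T W)"
      by (simp add: orth_pair_left_iff[OF decomposition])
    have X'C: "orth X' C"
    proof (rule orthI)
      fix x assume x: "x \<in> Hom T X' C"
      have "h \<cdot> x = 0"
        using comp_in_Hom[OF x m(2)] X'W by simp
      then obtain y where y: "y \<in> Hom T X' Z" "x = c \<cdot> y"
        using dist_lift2[OF D x] by blast
      obtain a where a: "a \<in> Hom T X' W" "y = w \<cdot> a"
        using cover[OF y(1)] by blast
      show "x = 0"
        using y(2) a comp_assoc[OF a(1) w m(1)] dist_comp_zero[OF D] comp_zero_left[OF a(1)] by simp
    qed
    have CS: "orth C S"
    proof (rule dist_orth_left_mid[OF dist_rot[OF D] ZS])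
      show "orth (sh1 T W) S"
        using orth_lt0_ge0[OF lt0_sh1[OF W], of S] heart(2) by (simp add: heart_iff)
    qed
    have C: "le0 C"
      by (rule le0_cone[OF D W Z])
    have "orth X C"
    proof (rule ccontr)
      assume "\<not> orth X C"
      then have MC: "\<not> orth M C"
        by (simp add: orth_pair_left_iff[OF decomposition])
      obtain A Q a q h' where Q: "dist T A C Q a q h'" "lt0 A" "Q \<in> \<H>"
        using truncate[OF C] .
      have q: "q \<in> Hom T C Q"
        using dist_in_Hom[OF Q(1)] by auto
      obtain m where m: "m \<in> Hom T M C" "m \<noteq> 0"
        using MC orthI by blast
      then have "q \<cdot> m \<noteq> 0"
        using inj_from_M_truncate[OF Q(1,2)] by blast
      then have "\<not> zero_object T Q"
        using comp_in_Hom[OF m(1) q] unfolding zero_object_def by auto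
      moreover obtain B where "finite B" "span B = Hom T M Q"
        using Hom_fin unfolding Hom_finite_def by blast
      ultimately obtain S1 r where S1: "simple_in T \<H> S1" and r: "r \<in> Hom T Q S1" "r \<noteq> 0"
        using simple_quotient[OF Q(3)] by blast
      have S1_heart: "S1 \<in> \<H>"
        using S1 unfolding simple_in_def by blast
      define \<phi> where "\<phi> = r \<cdot> q"
      have \<phi>: "\<phi> \<in> Hom T C S1" "\<phi> \<noteq> 0"
        using comp_in_Hom[OF q r(1)] heart_cancel[OF Q(1,2) S1_heart r(1)] r(2) unfolding \<phi>_def by auto
      have surj: "surj_from_M C S1 \<phi>"
        by (rule simple_surj_from_M[OF C S1 \<phi>])
      obtain k l where kl: "k \<in> Hom T X' M" "l \<in> Hom T M X'" "l \<cdot> k = Id T X'"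
        by (rule X'_retract)
      \<comment> \<open>Maps from \<open>X'\<close> to \<open>S1\<close> would lift along \<phi> to
        \<open>C\<close>, which has none. So \<open>X\<close> maps nontrivially to
        \<open>S1\<close>, and \<open>S1\<close> becomes a quotient of \<open>H\<close>.\<close>
      have "orth X' S1"
      proof (rule orthI)
        fix y assume "y \<in> Hom T X' S1"
        then obtain a where "a \<in> Hom T X' C" "y = \<phi> \<cdot> a"
          using surj_from_retract[OF kl surj] by blast
        then show "y = 0"
          using X'C comp_zero_right[OF \<phi>(1)] by simp
      qed
      then have "\<not> orth X S1"
        using simple_nonzero[OF S1] orth_pair_left_iff[OF decomposition, of S1] by simp
      then obtain x where x: "x \<in> Hom T X S1" "x \<noteq> 0"
        using orthI by blast
      obtain e where e: "e \<in> Hom T X H" "\<exists>w\<in>Hom T H S1. x = w \<cdot> e"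
        using H0_map[OF H heart(1)] S1_heart x(1) by metis
      then obtain w' where w': "w' \<in> Hom T H S1" "w' \<noteq> 0"
        using x(2) comp_zero_left[OF e(1)] by metis
      have "semisimple_in T \<H> S1"
        unfolding semisimple_in_def using S1_heart S1 direct_sum_singleton[of S1]
        by (intro conjI exI[of _ "[S1]"]) auto
      \<comment> \<open>The universal property of the top sends \<open>S\<close> onto
        \<open>S1\<close>; by Schur's lemma \<open>S1\<close> is isomorphic to a simple summand of
        \<open>S\<close>, contradicting that \<open>C\<close> has no maps to
        \<open>S\<close>.\<close>
      from univ[rule_format, OF this simple_epi[OF heart(1) S1 w']]
      obtain t where t: "t \<in> Hom T S S1" "w' = t \<cdot> p"
        by (elim bexE)
      then have "t \<noteq> 0"
        using w'(2) comp_zero_left[OF pm] by blast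
      then obtain S' i' q' where S': "S' \<in> set Ss" "i' \<in> Hom T S' S" "q' \<in> Hom T S S'"
        "q' \<cdot> i' = Id T S'" "t \<cdot> i' \<noteq> 0"
        using direct_sum_nonzero_left[OF Ss(2) t(1)] by metis
      have ti: "t \<cdot> i' \<in> Hom T S' S1"
        by (rule comp_in_Hom[OF S'(2) t(1)])
      obtain s where s: "s \<in> Hom T S1 S'" "(t \<cdot> i') \<cdot> s = Id T S1"
        by (rule schur[OF Ss(1)[OF S'(1)] S1 ti S'(5)])
      have "orth C S'"
        by (rule orth_retract_right[OF S'(2-4) CS])
      then have "s \<cdot> \<phi> = 0"
        using comp_in_Hom[OF \<phi>(1) s(1)] by simp
      then have "\<phi> = 0"
        using comp_assoc[OF \<phi>(1) s(1) ti] s(2) comp_Id_left[OF \<phi>(1)] comp_zero_right[OF ti] by simp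
      then show False
        using \<phi>(2) by simp
    qed
    then show "\<forall>u\<in>Hom T X Z. \<exists>v\<in>Hom T X0 Z. u = v \<cdot> f"
    proof (intro ballI)
      fix u assume u: "u \<in> Hom T X Z"
      have "c \<cdot> u = 0"
        using comp_in_Hom[OF u m(1)] \<open>orth X C\<close> by simp
      then obtain v where v: "v \<in> Hom T X W" "u = w \<cdot> v"
        using dist_lift[OF D u] by blast
      obtain y where y: "y \<in> Hom T X0 W" "v = y \<cdot> f"
        using PW v(1) unfolding P_def by blast
      have "u = (w \<cdot> y) \<cdot> f"
        using v(2) y(2) comp_assoc[OF fm y(1) w] by simp
      then show "\<exists>v\<in>Hom T X0 Z. u = v \<cdot> f"
        using comp_in_Hom[OF y(1) w] by blast
    qed
  }
qed

end

theorem theorem4p1: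
  fixes T :: "('k::field, 'o, 'm::ab_group_add) tri_cat"
    and \<nu> \<nu>' :: "('o, 'm) endofunctor"
    and d :: int
    and M X X' H S N :: 'o
  assumes "triangulated_category T"
    and "silting T M"
    and T0: "Hom_finite T" "Krull_Schmidt T"
    and T1: "Serre_functor T \<nu>" "quasi_inverse T \<nu> \<nu>'"
    and T2: "admits_right_adjacent_t_structure T M"
    and T3: "d_silting T \<nu>' d M"
    and decomposition: "direct_sum T [X, X'] M"
      "add_closure T X \<inter> add_closure T X' = {Z. zero_object T Z}"
    and S: "is_H0 T M X H" "is_top T (heart T M) H S"
    and mutation: "left_mutation T X X' N"
  shows "d_silting T \<nu>' d N \<longleftrightarrow> Hom T S (sh T d X') = {0}"
proof -
  interpret triangulated_category T
    by fact
  interpret serre_category T \<nu> \<nu>'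
    by unfold_locales fact+
  interpret silting_decomposition T M X X'
    by unfold_locales fact+
  let ?G = "nu_d_inv T \<nu>' d"
  obtain X0 Y f g h where f: "left_approximation T (add_closure T X') X X0 f"
    and D: "dist T X X0 Y f g h" and N: "direct_sum T [Y, X'] N"
    using mutation unfolding left_mutation_def by blast
  have X0: "X0 \<in> add_closure T X'"
    using f unfolding left_approximation_def by blast
  have add: "orth A (sh T j (?G X0))" if "orth A (sh T j (?G X'))" for A j
    using that orth_add_closure_right[OF X0] by (simp add: orth_nu_d_inv)
  have base: "orth A (sh T j (?G B))" if "A \<in> {X, X'}" "B \<in> {X, X'}" "0 < j" for A B j
  proof -
    have "orth M (sh T j (?G M))"
      using T3 \<open>0 < j\<close> unfolding d_silting_def silt_ge_def by blast
    then have "orth M (sh T j (?G B))"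
      using nu_d_inv_pair[OF decomposition(1), of M j d] that(2) by auto
    then show ?thesis
      using orth_pair_left_iff[OF decomposition(1), of "sh T j (?G B)"] that(1) by auto
  qed
  have "silting T N"
    by (rule silting_left_mutation[OF assms(2) decomposition(1) f D N])
  then have "d_silting T \<nu>' d N \<longleftrightarrow> (\<forall>j>0. orth N (sh T j (?G N)))"
    unfolding d_silting_def silt_ge_def by blast
  also have "\<dots> \<longleftrightarrow> (\<forall>u\<in>Hom T X (?G X'). \<exists>v\<in>Hom T X0 (?G X'). u = v \<cdot>\<^bsub>T\<^esub> f)"
    \<comment> \<open>The reduction used for silting of \<open>N\<close>, now with
      \<open>\<nu>\<^sub>d\<inverse>\<close> in the second argument.\<close>
    by (rule mutation_orth_iff[OF D X0 N])
      (rule nu_d_inv_exact[OF D] add nu_d_inv_pair[OF N] base; assumption)+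
  also have "\<dots> \<longleftrightarrow> orth (?G X') S"
  proof (rule orth_top_iff_factors[OF S f, symmetric], intro allI impI)
    fix i :: int assume "0 < i"
    then show "orth M (sh T i (?G X'))"
      using base[of X X' i] base[of X' X' i] by (simp add: orth_pair_left_iff[OF decomposition(1)])
  qed
  also have "\<dots> \<longleftrightarrow> Hom T S (sh T d X') = {0}"
    by (rule orth_nu_d_inv_left)
  finally show ?thesis .
qed

end
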